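(* Let $n>0$ be sufficiently large. Let $A=\eta\cdot\mathbf{1}\mathbf{1}^\top+\Delta\in\mathbb{R}^{n\times n}$ be a random matrix, where $\eta=n^{c_0}$ for some sufficiently large constant $c_0$, $\mathbf{1}\in\mathbb{R}^n$ is the all-ones vector, and the entries $\Delta_{i,j}$, $i,j\in[n]$, are i.i.d. standard Cauchy random variables. Let $r=n^{o(1)}$. Then with probability at least $1-O(1/\log\log n)$, for every $S\subseteq[n]$ with $|S|=r$, $$\min_{X\in\mathbb{R}^{r\times n}}\|A_SX-A\|_1\ge 1.002\,\|\Delta\|_1.$$
   Context: A standard Cauchy random variable has density $f(z)=\frac{1}{\pi(1+z^2)}$. For a matrix $M$, $\|M\|_1=\sum_{i,j}|M_{i,j}|$. For $S\subseteq[n]$, $A_S$ denotes the submatrix of $A$ formed by the columns with indices in $S$. *)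

theory Defs
  imports
    "HOL-Probability.Probability"
    "HOL-Library.Landau_Symbols"
    "Jordan_Normal_Form.DL_Submatrix"
begin

text \<open>Matrices have row and column indices \<open>0, \<dots>, n - 1\<close> instead of \<open>1, \<dots>, n\<close>.\<close>

definition l1_norm_mat :: "real mat \<Rightarrow> real" where
  "l1_norm_mat A = (\<Sum>i<dim_row A. \<Sum>j<dim_col A. \<bar>A $$ (i, j)\<bar>)"

definition col_submatrix :: "real mat \<Rightarrow> nat set \<Rightarrow> real mat" where
  "col_submatrix A S = submatrix A UNIV S"

text \<open>The minimum over \<open>X\<close> is rendered as an infimum over a nonempty family of
  nonnegative numbers; the two agree, because the distance from \<open>A\<close> to the (finite-dimensional,
  hence closed) space of all products \<open>A\<^sub>S X\<close> is attained.\<close>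

definition css_l1_cost :: "real mat \<Rightarrow> nat set \<Rightarrow> real" where
  "css_l1_cost A S =
     (INF X \<in> carrier_mat (card S) (dim_col A). l1_norm_mat (col_submatrix A S * X - A))"

definition cauchy_density :: "real \<Rightarrow> real" where
  "cauchy_density z = 1 / (pi * (1 + z\<^sup>2))"

definition iid_cauchy_mat :: "'a measure \<Rightarrow> nat \<Rightarrow> ('a \<Rightarrow> real mat) \<Rightarrow> bool" where
  "iid_cauchy_mat M n \<Delta> \<longleftrightarrow>
     (\<forall>\<omega>\<in>space M. \<Delta> \<omega> \<in> carrier_mat n n) \<and>
     prob_space.indep_vars M (\<lambda>_. borel) (\<lambda>(i, j) \<omega>. \<Delta> \<omega> $$ (i, j)) ({..<n} \<times> {..<n}) \<and>
     (\<forall>i<n. \<forall>j<n. distributed M lborel (\<lambda>\<omega>. \<Delta> \<omega> $$ (i, j)) (\<lambda>z. ennreal (cauchy_density z)))"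

definition ones_col :: "nat \<Rightarrow> real mat" where
  "ones_col n = mat n 1 (\<lambda>_. 1)"

definition shifted_mat :: "nat \<Rightarrow> real \<Rightarrow> real mat \<Rightarrow> real mat" where
  "shifted_mat n \<eta> D = \<eta> \<cdot>\<^sub>m (ones_col n * transpose_mat (ones_col n)) + D"

text \<open>\<open>r = n\<^sup>o\<^sup>(\<^sup>1\<^sup>)\<close>. In particular \<open>r n\<close> is eventually positive.\<close>

definition subpolynomial :: "(nat \<Rightarrow> nat) \<Rightarrow> bool" where
  "subpolynomial r \<longleftrightarrow>
     (\<exists>e :: nat \<Rightarrow> real. e \<in> o(\<lambda>_. 1) \<and> (\<forall>\<^sub>F n in sequentially. real (r n) = real n powr e n))"

end

theory Submission
  imports Defs "HOL-Real_Asymp.Real_Asymp"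
begin

text \<open>
  Write \<open>L = ln n\<close>. The residual of column \<open>j\<close> is \<open>t \<one> + \<Delta>\<^sub>S x - \<Delta>\<^sub>j\<close> with
  \<open>t = \<eta> (\<Sum>\<^sub>l x\<^sub>l - 1)\<close>. Either \<open>\<bar>t\<bar>\<close> is large, and then so is the residual, or
  \<open>\<Sum>\<^sub>l x\<^sub>l \<approx> 1\<close>, so that the coefficient vector \<open>(x, -1)\<close> has \<open>l\<^sub>1\<close>-norm at least \<open>2 - o(1)\<close>.
  By stability of the Cauchy law each entry of the residual then has Cauchy scale at least about 2, and after
  truncation at \<open>n\<^sup>1\<^sup>-\<^sup>\<delta>\<close> a Chernoff bound and a union bound over a grid of \<open>(S, j, x, t)\<close> show that every
  column costs at least about \<open>(4/\<pi>) n L\<close>. Over all columns this already gives \<open>(4/\<pi>) n\<^sup>2 L\<close>, the typical size of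
  \<open>\<parallel>\<Delta>\<parallel>\<^sub>1\<close>, but it only uses entries of size below \<open>n\<close>. The entries of size between \<open>n\<^sup>1\<^sup>+\<^sup>\<delta>\<close> and
  \<open>n\<^sup>2\<^sup>-\<^sup>\<delta>\<close>, which make up almost half of \<open>\<parallel>\<Delta>\<parallel>\<^sub>1\<close>, are not cancelled by \<open>\<Delta>\<^sub>S x\<close> either:
  outside the few rows in which some column of \<open>S\<close> exceeds \<open>n\<close>, a cancelling \<open>x\<close> would make the
  residual elsewhere even larger. A fixed fraction of their mass is therefore paid in addition, which
  leaves room for the factor \<open>1.002\<close>.

  The probability \<open>O(1 / ln ln n)\<close> of failure comes only from the truncation of \<open>\<parallel>\<Delta>\<parallel>\<^sub>1\<close> at
  \<open>n\<^sup>2 ln ln n\<close>; all other bad events are much rarer.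
\<close>

section \<open>Stability of the Cauchy distribution\<close>

definition scaled_cauchy_density :: "real \<Rightarrow> real \<Rightarrow> real" where
  "scaled_cauchy_density a z = a / (pi * (a\<^sup>2 + z\<^sup>2))"

lemma scaled_cauchy_density_nonneg: "0 \<le> a \<Longrightarrow> 0 \<le> scaled_cauchy_density a z"
  by (simp add: scaled_cauchy_density_def)

lemma scaled_cauchy_density_one: "scaled_cauchy_density 1 = cauchy_density"
  by (auto simp: scaled_cauchy_density_def cauchy_density_def)

lemma borel_measurable_scaled_cauchy_density [measurable]:
  "scaled_cauchy_density a \<in> borel_measurable borel"
  unfolding scaled_cauchy_density_def by measurable

text \<open>For \<open>z = 0\<close> and \<open>a = b\<close> the decomposition degenerates; this null set is harmless below.\<close>

lemma scaled_cauchy_partial_fractions: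
  fixes a b z u :: real
  assumes "0 < a" "0 < b" "z \<noteq> 0"
  defines "Q \<equiv> (z\<^sup>2 + (a + b)\<^sup>2) * (z\<^sup>2 + (a - b)\<^sup>2)"
  shows "scaled_cauchy_density a (z - u) * scaled_cauchy_density b u =
    a * b / (pi\<^sup>2 * Q) * (((z\<^sup>2 + a\<^sup>2 - b\<^sup>2) + 2 * z * u) / (b\<^sup>2 + u\<^sup>2)
      + ((z\<^sup>2 + b\<^sup>2 - a\<^sup>2) - 2 * z * (u - z)) / (a\<^sup>2 + (u - z)\<^sup>2))"
proof -
  have "b\<^sup>2 + u\<^sup>2 > 0" "a\<^sup>2 + (u - z)\<^sup>2 > 0" "Q > 0"
    using assms by (auto simp: Q_def add_pos_nonneg)
  \<comment> \<open>All powers of \<open>u\<close> cancel here and only the constant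
    \<open>Q\<close> is left; this is what determines the two linear numerators.\<close>
  moreover have "((z\<^sup>2 + a\<^sup>2 - b\<^sup>2) + 2 * z * u) * (a\<^sup>2 + (u - z)\<^sup>2)
      + ((z\<^sup>2 + b\<^sup>2 - a\<^sup>2) - 2 * z * (u - z)) * (b\<^sup>2 + u\<^sup>2) = Q"
    unfolding Q_def by (simp add: power2_eq_square algebra_simps)
  ultimately have "((z\<^sup>2 + a\<^sup>2 - b\<^sup>2) + 2 * z * u) / (b\<^sup>2 + u\<^sup>2)
      + ((z\<^sup>2 + b\<^sup>2 - a\<^sup>2) - 2 * z * (u - z)) / (a\<^sup>2 + (u - z)\<^sup>2)
      = Q / ((b\<^sup>2 + u\<^sup>2) * (a\<^sup>2 + (u - z)\<^sup>2))"
    by (subst add_frac_eq) (auto simp: mult.commute[of "a\<^sup>2 + _"] simp del: power2_eq_square)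
  then show ?thesis
    using \<open>Q > 0\<close> by (simp add: scaled_cauchy_density_def power2_commute[of z u] power2_eq_square[of pi] mult_ac)
qed

text \<open>As the integrand is nonnegative, its integrability is a consequence of the finite limits
  of \<open>F\<close> at both ends of the line.\<close>

lemma nn_integral_FTC_UNIV:
  fixes f F :: "real \<Rightarrow> real"
  assumes F: "\<And>x. (F has_real_derivative f x) (at x)"
    and f: "\<And>x. isCont f x" "\<And>x. 0 \<le> f x"
    and lim: "(F \<longlongrightarrow> A) at_bot" "(F \<longlongrightarrow> B) at_top"
  shows "(\<integral>\<^sup>+x. ennreal (f x) \<partial>lborel) = ennreal (B - A)"
proof -
  have e: "einterval (-\<infinity>) \<infinity> = UNIV"
    by (auto simp: einterval_def)
  have lim': "((F \<circ> real_of_ereal) \<longlongrightarrow> A) (at_right (-\<infinity>))" "((F \<circ> real_of_ereal) \<longlongrightarrow> B) (at_left \<infinity>)"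
    using lim by (simp_all add: ereal_tendsto_simps)
  note FTC = interval_integral_FTC_nonneg[of "-\<infinity>" \<infinity> F f, OF _ F f(1) _ lim']
  have 1: "set_integrable lborel (einterval (-\<infinity>) \<infinity>) f"
    by (rule FTC(1)) (use f in auto)
  have 2: "(LBINT x=-\<infinity>..\<infinity>. f x) = B - A"
    by (rule FTC(2)) (use f in auto)
  have "integrable lborel f"
    using 1 unfolding e by (simp add: set_integrable_def)
  moreover have "integral\<^sup>L lborel f = B - A"
    using 2 unfolding interval_lebesgue_integral_def e by (simp add: set_lebesgue_integral_def)
  ultimately show ?thesis
    using f by (simp add: nn_integral_eq_integral)
qed

text \<open>The partial fractions integrate to two arctangents and a difference of two logarithms.
  That difference vanishes at both ends of the line, so the integral is the total jump of the
  arctangents. The condition \<open>z \<noteq> 0\<close> keeps \<open>Q\<close> positive also when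
  \<open>a = b\<close>.\<close>

lemma nn_integral_scaled_cauchy_convolution:
  assumes a: "0 < a" and b: "0 < b" and z: "z \<noteq> 0"
  shows "(\<integral>\<^sup>+u. ennreal (scaled_cauchy_density a (z - u)) * ennreal (scaled_cauchy_density b u) \<partial>lborel)
    = ennreal (scaled_cauchy_density (a + b) z)"
proof -
  define Q where "Q = (z\<^sup>2 + (a + b)\<^sup>2) * (z\<^sup>2 + (a - b)\<^sup>2)"
  define A where "A = z\<^sup>2 + a\<^sup>2 - b\<^sup>2"
  define C where "C = z\<^sup>2 + b\<^sup>2 - a\<^sup>2"
  define F where "F u = a * b / (pi\<^sup>2 * Q) * (A / b * arctan (u / b) + C / a * arctan ((u - z) / a)
      + z * (ln (b\<^sup>2 + u\<^sup>2) - ln (a\<^sup>2 + (u - z)\<^sup>2)))" for u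
  define f where "f u = a * b / (pi\<^sup>2 * Q) * ((A + 2 * z * u) / (b\<^sup>2 + u\<^sup>2)
      + (C - 2 * z * (u - z)) / (a\<^sup>2 + (u - z)\<^sup>2))" for u
  \<comment> \<open>The limit of \<open>F\<close> at infinity. The arctangents have opposite limits
    at minus infinity, so the integral becomes \<open>l - (- l)\<close>.\<close>
  define l where "l = a * b / (pi\<^sup>2 * Q) * (A / b + C / a) * (pi / 2)"
  have pos: "b\<^sup>2 + u\<^sup>2 > 0" "a\<^sup>2 + (u - z)\<^sup>2 > 0" "Q > 0" for u
    using assms by (auto simp: Q_def add_pos_nonneg)
  have f: "f u = scaled_cauchy_density a (z - u) * scaled_cauchy_density b u" for u
    unfolding f_def A_def C_def Q_def by (rule scaled_cauchy_partial_fractions[OF a b z, symmetric])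
  have dF: "(F has_real_derivative f u) (at u)" for u
  proof -
    have darctan: "((\<lambda>u. arctan ((u - w) / c)) has_real_derivative c / (c\<^sup>2 + (u - w)\<^sup>2)) (at u)"
      if "c > 0" for c w
    proof -
      have "c\<^sup>2 + (u - w)\<^sup>2 > 0" using that by (simp add: add_pos_nonneg)
      then have "inverse (1 + ((u - w) / c)\<^sup>2) * (1 / c) = c / (c\<^sup>2 + (u - w)\<^sup>2)"
        using that by (simp add: field_simps power2_eq_square)
      moreover have "((\<lambda>u. arctan ((u - w) / c)) has_real_derivative inverse (1 + ((u - w) / c)\<^sup>2) * (1 / c)) (at u)"
        using that by (auto intro!: derivative_eq_intros)
      ultimately show ?thesis by simp
    qed
    have dln: "((\<lambda>u. ln (c\<^sup>2 + (u - w)\<^sup>2)) has_real_derivative 2 * (u - w) / (c\<^sup>2 + (u - w)\<^sup>2)) (at u)"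
      if "c > 0" for c w
      using that by (auto intro!: derivative_eq_intros simp: add_pos_nonneg)
    have "(F has_real_derivative a * b / (pi\<^sup>2 * Q) *
        (A / b * (b / (b\<^sup>2 + u\<^sup>2)) + C / a * (a / (a\<^sup>2 + (u - z)\<^sup>2))
          + z * (2 * u / (b\<^sup>2 + u\<^sup>2) - 2 * (u - z) / (a\<^sup>2 + (u - z)\<^sup>2)))) (at u)"
      unfolding F_def
      using darctan[OF b, of 0] darctan[OF a, of z] dln[OF b, of 0] dln[OF a, of z]
      by (intro DERIV_cmult DERIV_add DERIV_diff) simp_all
    moreover have "A / b * (b / (b\<^sup>2 + u\<^sup>2)) + C / a * (a / (a\<^sup>2 + (u - z)\<^sup>2))
          + z * (2 * u / (b\<^sup>2 + u\<^sup>2) - 2 * (u - z) / (a\<^sup>2 + (u - z)\<^sup>2))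
        = (A + 2 * z * u) / (b\<^sup>2 + u\<^sup>2) + (C - 2 * z * (u - z)) / (a\<^sup>2 + (u - z)\<^sup>2)"
      using a b by (simp add: add_divide_distrib diff_divide_distrib right_diff_distrib mult_ac)
    ultimately show ?thesis
      unfolding f_def by simp
  qed
  have logtop: "((\<lambda>u. ln (b\<^sup>2 + u\<^sup>2) - ln (a\<^sup>2 + (u - z)\<^sup>2)) \<longlongrightarrow> 0) at_top"
    by real_asymp
  have logbot: "((\<lambda>u. ln (b\<^sup>2 + u\<^sup>2) - ln (a\<^sup>2 + (u - z)\<^sup>2)) \<longlongrightarrow> 0) at_bot"
    by real_asymp
  have at_top: "((\<lambda>u. arctan ((u - w) / c)) \<longlongrightarrow> pi / 2) at_top" if "c > 0" for c w
    using that by real_asymp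
  have at_bot: "((\<lambda>u. arctan ((u - w) / c)) \<longlongrightarrow> - (pi / 2)) at_bot" if "c > 0" for c w
    using that by real_asymp
  have top: "(F \<longlongrightarrow> a * b / (pi\<^sup>2 * Q) * (A / b * (pi / 2) + C / a * (pi / 2) + z * 0)) at_top"
    unfolding F_def using at_top[OF b, of 0] at_top[OF a, of z] logtop by (intro tendsto_intros) auto
  have bot: "(F \<longlongrightarrow> a * b / (pi\<^sup>2 * Q) * (A / b * (-(pi / 2)) + C / a * (-(pi / 2)) + z * 0)) at_bot"
    unfolding F_def using at_bot[OF b, of 0] at_bot[OF a, of z] logbot by (intro tendsto_intros) auto
  have "(\<integral>\<^sup>+u. ennreal (f u) \<partial>lborel) = ennreal (l - (- l))"
  proof (rule nn_integral_FTC_UNIV[OF dF])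
    show "isCont f u" for u
      unfolding f_def using pos(1,2)[of u] by (intro continuous_intros) auto
    show "0 \<le> f u" for u
      unfolding f using a b by (simp add: scaled_cauchy_density_nonneg)
    show "(F \<longlongrightarrow> - l) at_bot"
    proof -
      have "a * b / (pi\<^sup>2 * Q) * (A / b * (-(pi / 2)) + C / a * (-(pi / 2)) + z * 0) = - l"
      proof -
        have "k * (x * - h + y * - h + z * 0) = - (k * (x + y) * h)" for k x y h :: real
          by (simp add: algebra_simps)
        then show ?thesis unfolding l_def .
      qed
      with bot show ?thesis by simp
    qed
    show "(F \<longlongrightarrow> l) at_top"
    proof -
      have "a * b / (pi\<^sup>2 * Q) * (A / b * (pi / 2) + C / a * (pi / 2) + z * 0) = l"
      proof -
        have "k * (x * h + y * h + z * 0) = k * (x + y) * h" for k x y h :: real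
          by (simp add: algebra_simps)
        then show ?thesis unfolding l_def .
      qed
      with top show ?thesis by simp
    qed
  qed
  moreover have "l - (- l) = scaled_cauchy_density (a + b) z"
  proof -
    \<comment> \<open>The factor \<open>z\<^sup>2 + (a - b)\<^sup>2\<close> exposed here cancels
      against the same factor of \<open>Q\<close>, which leaves the density of scale
      \<open>a + b\<close>.\<close>
    have n: "(a + b) * (z\<^sup>2 + (a - b)\<^sup>2) = A * a + C * b"
      unfolding A_def C_def by (simp add: power2_eq_square algebra_simps)
    have p: "z\<^sup>2 + (a - b)\<^sup>2 > 0" "z\<^sup>2 + (a + b)\<^sup>2 > 0"
      using z by (auto simp: add_pos_nonneg)
    have "l - (- l) = (A * a + C * b) / (pi * Q)"
      using a b pos(3) by (simp add: l_def divide_simps power2_eq_square)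
    also have "\<dots> = scaled_cauchy_density (a + b) z"
      unfolding n[symmetric] Q_def scaled_cauchy_density_def using p z
      by (simp add: add.commute)
    finally show ?thesis .
  qed
  ultimately show ?thesis
    using a b by (simp add: f ennreal_mult scaled_cauchy_density_nonneg)
qed

context prob_space
begin

text \<open>The convolution integral is evaluated only away from zero. This suffices because the law
  depends on the density only up to null sets.\<close>

lemma distributed_scaled_cauchy_add:
  assumes "indep_var borel X borel Y" "0 < a" "0 < b"
    and "distributed M lborel X (scaled_cauchy_density a)"
    and "distributed M lborel Y (scaled_cauchy_density b)"
  shows "distributed M lborel (\<lambda>\<omega>. X \<omega> + Y \<omega>) (scaled_cauchy_density (a + b))"
proof -
  let ?h = "\<lambda>x. \<integral>\<^sup>+y. ennreal (scaled_cauchy_density a (x - y)) * ennreal (scaled_cauchy_density b y) \<partial>lborel"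
  have d: "distributed M lborel (\<lambda>\<omega>. X \<omega> + Y \<omega>) ?h"
    using assms by (intro distributed_convolution)
  have "AE x::real in lborel. x \<noteq> 0"
    by (rule AE_lborel_singleton)
  then have "AE x in lborel. ?h x = ennreal (scaled_cauchy_density (a + b) x)"
    by eventually_elim (use assms in \<open>simp add: nn_integral_scaled_cauchy_convolution\<close>)
  then have "density lborel ?h = density lborel (\<lambda>x. ennreal (scaled_cauchy_density (a + b) x))"
    by (intro density_cong) (use d in \<open>auto dest: distributed_borel_measurable\<close>)
  with d show ?thesis
    by (simp add: distributed_def)
qed

lemma distributed_scaled_cauchy_cmult:
  assumes "distributed M lborel X (scaled_cauchy_density a)" "0 < a" "c \<noteq> 0"
  shows "distributed M lborel (\<lambda>\<omega>. c * X \<omega>) (scaled_cauchy_density (\<bar>c\<bar> * a))"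
proof -
  have "distributed M lborel (\<lambda>\<omega>. 0 + c * X \<omega>) (\<lambda>x. ennreal (scaled_cauchy_density a ((x - 0) / c)) / \<bar>c\<bar>)"
    using assms by (intro distributed_affine)
  moreover have "ennreal (scaled_cauchy_density a ((x - 0) / c)) / \<bar>c\<bar> = scaled_cauchy_density (\<bar>c\<bar> * a) x" for x
  proof -
    have "c\<^sup>2 * (a\<^sup>2 + (x / c)\<^sup>2) = (\<bar>c\<bar> * a)\<^sup>2 + x\<^sup>2"
      using assms by (simp add: field_simps power_mult_distrib power_divide)
    then have "scaled_cauchy_density (\<bar>c\<bar> * a) x = \<bar>c\<bar> * a / (\<bar>c\<bar> * (\<bar>c\<bar> * (pi * (a\<^sup>2 + (x / c)\<^sup>2))))"
      unfolding scaled_cauchy_density_def using assms(3)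
      by (simp add: power2_eq_square[of c, symmetric] flip: mult.assoc abs_mult)
    then have "scaled_cauchy_density a (x / c) / \<bar>c\<bar> = scaled_cauchy_density (\<bar>c\<bar> * a) x"
      using assms unfolding scaled_cauchy_density_def by simp
    then show ?thesis
      using assms by (simp add: divide_ennreal scaled_cauchy_density_nonneg)
  qed
  ultimately show ?thesis by simp
qed

lemma distributed_scaled_cauchy_sum:
  assumes "finite I" "I \<noteq> {}" "indep_vars (\<lambda>_. borel) X I"
    and "\<And>i. i \<in> I \<Longrightarrow> 0 < a i"
    and "\<And>i. i \<in> I \<Longrightarrow> distributed M lborel (X i) (scaled_cauchy_density (a i))"
  shows "distributed M lborel (\<lambda>\<omega>. \<Sum>i\<in>I. X i \<omega>) (scaled_cauchy_density (\<Sum>i\<in>I. a i))"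
  using assms
proof (induct I rule: finite_ne_induct)
  case (singleton i) then show ?case by simp
next
  case (insert i I)
  have "distributed M lborel (\<lambda>\<omega>. X i \<omega> + (\<Sum>i\<in>I. X i \<omega>)) (scaled_cauchy_density (a i + sum a I))"
    using insert by (intro distributed_scaled_cauchy_add indep_vars_sum)
      (auto intro: indep_vars_subset intro!: sum_pos)
  then show ?case using insert by simp
qed

text \<open>A term with coefficient zero has no density, so the sum is first restricted to the
  support of \<open>c\<close>, which is nonempty by the last hypothesis.\<close>

lemma distributed_cauchy_linear_combination:
  assumes fin: "finite I" and ind: "indep_vars (\<lambda>_. borel) X I"
    and X: "\<And>i. i \<in> I \<Longrightarrow> distributed M lborel (X i) cauchy_density"
    and c: "(\<Sum>i\<in>I. \<bar>c i\<bar>) \<noteq> 0"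
  shows "distributed M lborel (\<lambda>\<omega>. \<Sum>i\<in>I. c i * X i \<omega>) (scaled_cauchy_density (\<Sum>i\<in>I. \<bar>c i\<bar>))"
proof -
  define J where "J = {i \<in> I. c i \<noteq> 0}"
  have J: "J \<subseteq> I" "finite J" using fin by (auto simp: J_def)
  have ne: "J \<noteq> {}" using c fin by (auto simp: J_def sum_nonneg_eq_0_iff)
  have "indep_vars (\<lambda>_. borel) (\<lambda>i \<omega>. c i * X i \<omega>) J"
    by (rule indep_vars_compose2[OF indep_vars_subset[OF ind J(1)], where Y="\<lambda>i x. c i * x"]) auto
  then have "distributed M lborel (\<lambda>\<omega>. \<Sum>i\<in>J. c i * X i \<omega>) (scaled_cauchy_density (\<Sum>i\<in>J. \<bar>c i\<bar> * 1))"
    using J ne X by (intro distributed_scaled_cauchy_sum distributed_scaled_cauchy_cmult)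
      (auto simp: J_def scaled_cauchy_density_one)
  moreover have "(\<Sum>i\<in>J. c i * X i \<omega>) = (\<Sum>i\<in>I. c i * X i \<omega>)" for \<omega>
    using fin by (intro sum.mono_neutral_left) (auto simp: J_def)
  moreover have "(\<Sum>i\<in>J. \<bar>c i\<bar>) = (\<Sum>i\<in>I. \<bar>c i\<bar>)"
    using fin by (intro sum.mono_neutral_left) (auto simp: J_def)
  ultimately show ?thesis by simp
qed

end

section \<open>Truncated moments and Chernoff bounds\<close>

lemma two_mult_ennreal: "2 * ennreal x = ennreal (2 * x)"
  using ennreal_mult'[of 2 x] by simp

lemma nn_integral_comp_abs:
  fixes g :: "real \<Rightarrow> ennreal"
  assumes [measurable]: "g \<in> borel_measurable borel"
  shows "(\<integral>\<^sup>+x. g \<bar>x\<bar> \<partial>lborel) = 2 * (\<integral>\<^sup>+x. g x * indicator {0..} x \<partial>lborel)"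
proof -
  have "(\<integral>\<^sup>+x. g \<bar>x\<bar> \<partial>lborel)
      = (\<integral>\<^sup>+x. g x * indicator {0..} x + g \<bar>x\<bar> * indicator {..<0} x \<partial>lborel)"
    by (intro nn_integral_cong) (auto split: split_indicator)
  also have "\<dots> = (\<integral>\<^sup>+x. g x * indicator {0..} x \<partial>lborel) + (\<integral>\<^sup>+x. g \<bar>x\<bar> * indicator {..<0} x \<partial>lborel)"
    by (rule nn_integral_add) auto
  also have "(\<integral>\<^sup>+x. g \<bar>x\<bar> * indicator {..<0} x \<partial>lborel)
      = (\<integral>\<^sup>+x. g \<bar>0 + (-1) * x\<bar> * indicator {..<0} (0 + (-1) * x) \<partial>lborel)"
    by (subst nn_integral_real_affine[where c="-1" and t=0]) auto
  also have "\<dots> = (\<integral>\<^sup>+x. g x * indicator {0..} x \<partial>lborel)"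
  proof (rule nn_integral_cong_AE)
    have "AE x::real in lborel. x \<noteq> 0" by (rule AE_lborel_singleton)
    then show "AE x in lborel. g \<bar>0 + (-1) * x\<bar> * indicator {..<0} (0 + (-1) * x) = g x * indicator {0..} x"
      by eventually_elim (auto split: split_indicator)
  qed
  finally show ?thesis by (simp add: mult_2)
qed

lemma borel_measurable_cauchy_density [measurable]: "cauchy_density \<in> borel_measurable borel"
  unfolding cauchy_density_def by measurable

lemma cauchy_density_nonneg: "0 \<le> cauchy_density z"
  by (simp add: cauchy_density_def)

text \<open>Values outside the window become zero instead of being clipped, so the mean is the plain
  integral of the absolute value over the window. With \<open>a = 0\<close> nothing is lost as long
  as no entry exceeds \<open>b\<close>.\<close>

definition abs_within :: "real \<Rightarrow> real \<Rightarrow> real \<Rightarrow> real" where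
  "abs_within a b x = (if a \<le> \<bar>x\<bar> \<and> \<bar>x\<bar> \<le> b then \<bar>x\<bar> else 0)"

lemma abs_within_bounds: "0 \<le> b \<Longrightarrow> 0 \<le> abs_within a b x \<and> abs_within a b x \<le> b"
  by (auto simp: abs_within_def)

lemma borel_measurable_abs_within [measurable]: "abs_within a b \<in> borel_measurable borel"
  unfolding abs_within_def by measurable

text \<open>From 1 + u <= exp u and the factorization (1 - u + u^2)(1 + u) = 1 + u^3.\<close>

lemma exp_uminus_le_quadratic:
  fixes u :: real
  assumes "0 \<le> u"
  shows "exp (- u) \<le> 1 - u + u\<^sup>2"
proof -
  have "1 \<le> (1 - u + u\<^sup>2) * (1 + u)"
    using assms by (simp add: algebra_simps power2_eq_square)
  also have "\<dots> \<le> (1 - u + u\<^sup>2) * exp u"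
  proof (intro mult_left_mono)
    have "1 - u + u\<^sup>2 = (1 - u / 2)\<^sup>2 + 3 / 4 * u\<^sup>2"
      by (simp add: power2_eq_square algebra_simps)
    also have "\<dots> \<ge> 0" by simp
    finally show "0 \<le> 1 - u + u\<^sup>2" .
  qed auto
  finally show ?thesis
    by (simp add: exp_minus field_simps)
qed

context prob_space
begin

lemma nn_integral_cauchy_abs:
  fixes g :: "real \<Rightarrow> ennreal"
  assumes X: "distributed M lborel X cauchy_density" and [measurable]: "g \<in> borel_measurable borel"
  shows "(\<integral>\<^sup>+\<omega>. g \<bar>X \<omega>\<bar> \<partial>M) = 2 * (\<integral>\<^sup>+x. ennreal (cauchy_density x) * g x * indicator {0..} x \<partial>lborel)"
proof -
  have "(\<integral>\<^sup>+\<omega>. g \<bar>X \<omega>\<bar> \<partial>M) = (\<integral>\<^sup>+x. ennreal (cauchy_density x) * g \<bar>x\<bar> \<partial>lborel)"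
    using distributed_nn_integral[OF X, of "\<lambda>x. g \<bar>x\<bar>"] by simp
  also have "\<dots> = (\<integral>\<^sup>+x. ennreal (cauchy_density \<bar>x\<bar>) * g \<bar>x\<bar> \<partial>lborel)"
    by (simp add: cauchy_density_def)
  also have "\<dots> = 2 * (\<integral>\<^sup>+x. ennreal (cauchy_density x) * g x * indicator {0..} x \<partial>lborel)"
    by (rule nn_integral_comp_abs[where g="\<lambda>x. ennreal (cauchy_density x) * g x"]) auto
  finally show ?thesis .
qed

text \<open>\<open>x * cauchy_density x\<close> has the antiderivative ln (1 + x^2) / (2 pi), and
  the two signs double it. A window from n^alpha to n^beta with 0 < alpha < beta thus carries mass
  about (2 / pi) (beta - alpha) ln n, so all logarithmic scales count alike.\<close>

lemma expectation_cauchy_abs_within: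
  assumes X: "distributed M lborel X cauchy_density" and ab: "0 \<le> a" "a \<le> b"
  shows "expectation (\<lambda>\<omega>. abs_within a b (X \<omega>)) = (ln (1 + b\<^sup>2) - ln (1 + a\<^sup>2)) / pi"
proof -
  have [measurable]: "X \<in> borel_measurable M"
    using distributed_measurable[OF X] by simp
  define F where "F x = ln (1 + x\<^sup>2) / (2 * pi)" for x :: real
  have "(\<integral>\<^sup>+\<omega>. ennreal (abs_within a b (X \<omega>)) \<partial>M) = (\<integral>\<^sup>+\<omega>. ennreal (abs_within a b \<bar>X \<omega>\<bar>) \<partial>M)"
    by (intro nn_integral_cong) (auto simp: abs_within_def)
  also have "\<dots> = 2 * (\<integral>\<^sup>+x. ennreal (cauchy_density x) * ennreal (abs_within a b x) * indicator {0..} x \<partial>lborel)"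
    by (rule nn_integral_cauchy_abs[OF X, where g="\<lambda>x. ennreal (abs_within a b x)"]) auto
  also have "(\<integral>\<^sup>+x. ennreal (cauchy_density x) * ennreal (abs_within a b x) * indicator {0..} x \<partial>lborel)
      = (\<integral>\<^sup>+x. ennreal (x * cauchy_density x) * indicator {a..b} x \<partial>lborel)"
    using ab by (intro nn_integral_cong)
      (auto simp: abs_within_def cauchy_density_nonneg ennreal_mult mult.commute split: split_indicator)
  also have "\<dots> = ennreal (F b - F a)"
  proof (rule nn_integral_FTC_Icc)
    fix x assume "x \<in> {a..b}"
    have "1 + x\<^sup>2 > 0" by (simp add: add_pos_nonneg)
    then have "((\<lambda>x. ln (1 + x\<^sup>2)) has_real_derivative 2 * x / (1 + x\<^sup>2)) (at x)"
      by (auto intro!: derivative_eq_intros)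
    then show "(F has_real_derivative x * cauchy_density x) (at x)"
      unfolding F_def cauchy_density_def
      by (rule DERIV_cong[OF DERIV_cdivide]) simp
    show "0 \<le> x * cauchy_density x"
      using ab \<open>x \<in> {a..b}\<close> by (simp add: cauchy_density_nonneg)
  qed (use ab in auto)
  also have "2 * \<dots> = ennreal (2 * (F b - F a))"
    by (rule two_mult_ennreal)
  finally have nn: "(\<integral>\<^sup>+\<omega>. ennreal (abs_within a b (X \<omega>)) \<partial>M) = ennreal (2 * (F b - F a))" .
  have "F a \<le> F b"
    unfolding F_def using ab by (intro divide_right_mono) (auto simp: add_pos_nonneg)
  moreover have "expectation (\<lambda>\<omega>. abs_within a b (X \<omega>)) = enn2real (\<integral>\<^sup>+\<omega>. ennreal (abs_within a b (X \<omega>)) \<partial>M)"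
    by (rule integral_eq_nn_integral) (auto simp: abs_within_def)
  ultimately have "expectation (\<lambda>\<omega>. abs_within a b (X \<omega>)) = 2 * (F b - F a)"
    unfolding nn by simp
  then show ?thesis by (simp add: F_def diff_divide_distrib)
qed

text \<open>The tail is exactly (2 / pi) arctan (1 / \<tau>), and the arctangent of a nonnegative
  number is at most that number.\<close>

lemma prob_cauchy_tail:
  assumes X: "distributed M lborel X cauchy_density" and "0 < \<tau>"
  shows "prob {\<omega> \<in> space M. \<tau> \<le> \<bar>X \<omega>\<bar>} \<le> 2 / (pi * \<tau>)"
proof -
  have [measurable]: "X \<in> borel_measurable M"
    using distributed_measurable[OF X] by simp
  have "emeasure M {\<omega> \<in> space M. \<tau> \<le> \<bar>X \<omega>\<bar>} = (\<integral>\<^sup>+\<omega>. indicator {\<omega> \<in> space M. \<tau> \<le> \<bar>X \<omega>\<bar>} \<omega> \<partial>M)"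
    by (rule nn_integral_indicator[symmetric]) measurable
  also have "\<dots> = (\<integral>\<^sup>+\<omega>. indicator {\<tau>..} \<bar>X \<omega>\<bar> \<partial>M)"
    by (intro nn_integral_cong) (auto split: split_indicator)
  also have "\<dots> = 2 * (\<integral>\<^sup>+x. ennreal (cauchy_density x) * indicator {\<tau>..} x * indicator {0..} x \<partial>lborel)"
    by (rule nn_integral_cauchy_abs[OF X]) auto
  also have "(\<integral>\<^sup>+x. ennreal (cauchy_density x) * indicator {\<tau>..} x * indicator {0..} x \<partial>lborel)
      = (\<integral>\<^sup>+x. ennreal (cauchy_density x) * indicator {\<tau>..} x \<partial>lborel)"
    using assms by (intro nn_integral_cong) (auto split: split_indicator)
  also have "\<dots> = ennreal (pi / 2 / pi - arctan \<tau> / pi)"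
  proof (rule nn_integral_FTC_atLeast)
    show "((\<lambda>x. arctan x / pi) \<longlongrightarrow> pi / 2 / pi) at_top"
      by (intro tendsto_intros tendsto_arctan_at_top) auto
    show "((\<lambda>x. arctan x / pi) has_real_derivative cauchy_density x) (at x)" for x
      unfolding cauchy_density_def
      by (rule DERIV_cong[OF DERIV_cdivide[OF DERIV_arctan]]) (simp add: divide_inverse)
  qed (auto simp: cauchy_density_nonneg)
  also have "2 * \<dots> = ennreal (2 * (pi / 2 / pi - arctan \<tau> / pi))"
    by (rule two_mult_ennreal)
  finally have "emeasure M {\<omega> \<in> space M. \<tau> \<le> \<bar>X \<omega>\<bar>} = ennreal (2 * (pi / 2 / pi - arctan \<tau> / pi))" .
  moreover have "2 * (pi / 2 / pi - arctan \<tau> / pi) \<le> 2 / (pi * \<tau>)"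
  proof -
    have "pi / 2 - arctan \<tau> = arctan (1 / \<tau>)"
      using assms arctan_inverse[of \<tau>] by (simp add: inverse_eq_divide)
    also have "\<dots> \<le> 1 / \<tau>"
      using assms by (intro arctan_le_self) auto
    finally have "2 / pi * (pi / 2 - arctan \<tau>) \<le> 2 / pi * (1 / \<tau>)"
      by (intro mult_left_mono) auto
    then show ?thesis by (simp add: right_diff_distrib)
  qed
  moreover have "0 \<le> 2 / (pi * \<tau>)" using assms by simp
  ultimately have "emeasure M {\<omega> \<in> space M. \<tau> \<le> \<bar>X \<omega>\<bar>} \<le> ennreal (2 / (pi * \<tau>))"
    by (simp add: ennreal_leI)
  then show ?thesis
    using \<open>0 \<le> 2 / (pi * \<tau>)\<close> by (simp add: emeasure_eq_measure)
qed

section \<open>Exponential moment bounds for independent sums\<close>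

text \<open>Markov's inequality for the exponential of the sum. The sign of \<open>l\<close> is free
  and the threshold is compared with \<open>l\<close> times the sum, so one statement serves upper
  and lower tails.\<close>

lemma Laplace_sum_tail:
  fixes Y :: "'i \<Rightarrow> 'a \<Rightarrow> real"
  assumes "finite I" and ind: "indep_vars (\<lambda>_. borel) Y I"
    and int: "\<And>i. i \<in> I \<Longrightarrow> integrable M (\<lambda>\<omega>. exp (l * Y i \<omega>))"
    and bound: "\<And>i. i \<in> I \<Longrightarrow> expectation (\<lambda>\<omega>. exp (l * Y i \<omega>)) \<le> exp \<kappa>"
  shows "prob {\<omega> \<in> space M. c \<le> l * (\<Sum>i\<in>I. Y i \<omega>)} \<le> exp (real (card I) * \<kappa> - c)"
proof -
  let ?E = "\<lambda>\<omega>. \<Prod>i\<in>I. exp (l * Y i \<omega>)"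
  have ind': "indep_vars (\<lambda>_. borel) (\<lambda>i \<omega>. exp (l * Y i \<omega>)) I"
    by (rule indep_vars_compose2[OF ind, where Y="\<lambda>_ y. exp (l * y)"]) auto
  have intE: "integrable M ?E"
    by (rule indep_vars_integrable[OF assms(1) ind' int])
  have E: "?E \<omega> = exp (l * (\<Sum>i\<in>I. Y i \<omega>))" for \<omega>
    using assms(1) by (simp add: exp_sum sum_distrib_left)
  have "prob {\<omega> \<in> space M. c \<le> l * (\<Sum>i\<in>I. Y i \<omega>)} = prob {\<omega> \<in> space M. exp c \<le> ?E \<omega>}"
    unfolding E by simp
  also have "\<dots> \<le> expectation ?E / exp c"
    by (rule integral_Markov_inequality_measure[OF intE, where A="{}"])
      (auto intro!: AE_I2 prod_nonneg)
  also have "expectation ?E = (\<Prod>i\<in>I. expectation (\<lambda>\<omega>. exp (l * Y i \<omega>)))"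
    by (rule indep_vars_lebesgue_integral[OF assms(1) ind' int])
  also have "\<dots> \<le> (\<Prod>i\<in>I. exp \<kappa>)"
    by (intro prod_mono conjI bound) (auto intro: integral_nonneg)
  finally show ?thesis
    by (simp add: exp_diff exp_of_nat_mult[symmetric] divide_right_mono)
qed

text \<open>Chernoff bounds with parameter \<open>l = \<epsilon> / (2 * b)\<close>. Then l Y is at
  most \<epsilon> / 2, so the quadratic term of the exponential is at most \<epsilon> / 2 times the
  linear one. Half of the deviation \<epsilon> survives and, multiplied by \<open>l\<close>, gives
  the exponent. Only one-sided bounds on the means enter, which later allows clean constants in
  place of the exact means.\<close>

lemma
  fixes Y :: "'i \<Rightarrow> 'a \<Rightarrow> real" and b \<mu> \<epsilon> :: real
  assumes I: "finite I" and ind: "indep_vars (\<lambda>_. borel) Y I"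
    and Y: "\<And>i \<omega>. i \<in> I \<Longrightarrow> 0 \<le> Y i \<omega> \<and> Y i \<omega> \<le> b"
    and b: "0 < b" and \<mu>: "0 \<le> \<mu>" and \<epsilon>: "0 < \<epsilon>" "\<epsilon> \<le> 1"
  shows bounded_sum_lower_tail:
      "(\<And>i. i \<in> I \<Longrightarrow> \<mu> \<le> expectation (Y i)) \<Longrightarrow>
        prob {\<omega> \<in> space M. (\<Sum>i\<in>I. Y i \<omega>) \<le> (1 - \<epsilon>) * (card I * \<mu>)} \<le> exp (- (card I * \<mu> * \<epsilon>\<^sup>2 / (4 * b)))"
    and bounded_sum_upper_tail:
      "(\<And>i. i \<in> I \<Longrightarrow> expectation (Y i) \<le> \<mu>) \<Longrightarrow>
        prob {\<omega> \<in> space M. (1 + \<epsilon>) * (card I * \<mu>) \<le> (\<Sum>i\<in>I. Y i \<omega>)} \<le> exp (- (card I * \<mu> * \<epsilon>\<^sup>2 / (4 * b)))"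
proof -
  define l where "l = \<epsilon> / (2 * b)"
  have l: "0 < l" "l * b = \<epsilon> / 2"
    using b \<epsilon> by (auto simp: l_def)
  have [measurable]: "Y i \<in> borel_measurable M" if "i \<in> I" for i
    using ind that by (auto simp: indep_vars_def)
  have int: "integrable M (Y i)" if "i \<in> I" for i
    by (rule integrable_const_bound[where B=b]) (use that Y b in \<open>auto simp: abs_le_iff order_trans[of _ 0]\<close>)
  have ly: "0 \<le> l * Y i \<omega>" "l * Y i \<omega> \<le> 1" "(l * Y i \<omega>)\<^sup>2 \<le> \<epsilon> / 2 * (l * Y i \<omega>)" if "i \<in> I" for i \<omega>
  proof -
    show 0: "0 \<le> l * Y i \<omega>" using Y[OF that] l by simp
    have 1: "l * Y i \<omega> \<le> \<epsilon> / 2" using Y[OF that] l by (metis mult_le_cancel_left_pos)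
    then show "l * Y i \<omega> \<le> 1" using \<epsilon> by simp
    show "(l * Y i \<omega>)\<^sup>2 \<le> \<epsilon> / 2 * (l * Y i \<omega>)"
      unfolding power2_eq_square by (rule mult_right_mono[OF 1 0])
  qed
  have int_exp: "integrable M (\<lambda>\<omega>. exp (l' * Y i \<omega>))" if "i \<in> I" "l' = l \<or> l' = - l" for i l'
    by (rule integrable_const_bound[where B="exp 1"])
      (use that ly[OF that(1)] in \<open>auto intro!: AE_I2 intro: order_trans[of _ 0]\<close>)
  {
    assume E: "\<And>i. i \<in> I \<Longrightarrow> \<mu> \<le> expectation (Y i)"
    have "expectation (\<lambda>\<omega>. exp (- l * Y i \<omega>)) \<le> exp (- (l * (1 - \<epsilon> / 2) * \<mu>))" if i: "i \<in> I" for i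
    proof -
      have "expectation (\<lambda>\<omega>. exp (- l * Y i \<omega>)) \<le> expectation (\<lambda>\<omega>. 1 - l * (1 - \<epsilon> / 2) * Y i \<omega>)"
      proof (rule integral_mono[OF int_exp[OF i]])
        fix \<omega>
        show "exp (- l * Y i \<omega>) \<le> 1 - l * (1 - \<epsilon> / 2) * Y i \<omega>"
          using exp_uminus_le_quadratic[OF ly(1)[OF i, of \<omega>]] ly(3)[OF i, of \<omega>]
          by (simp add: algebra_simps)
      qed (use int i in auto)
      also have "\<dots> = 1 - l * (1 - \<epsilon> / 2) * expectation (Y i)"
        using int[OF i] by (simp add: prob_space)
      also have "\<dots> \<le> 1 - l * (1 - \<epsilon> / 2) * \<mu>"
        using E[OF i] l \<epsilon> by (simp add: mult_left_mono)
      also have "\<dots> \<le> exp (- (l * (1 - \<epsilon> / 2) * \<mu>))"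
        using exp_ge_add_one_self[of "- (l * (1 - \<epsilon> / 2) * \<mu>)"] by simp
      finally show ?thesis .
    qed
    then have "prob {\<omega> \<in> space M. - l * ((1 - \<epsilon>) * (card I * \<mu>)) \<le> - l * (\<Sum>i\<in>I. Y i \<omega>)}
        \<le> exp (real (card I) * (- (l * (1 - \<epsilon> / 2) * \<mu>)) - - l * ((1 - \<epsilon>) * (card I * \<mu>)))"
      by (intro Laplace_sum_tail[OF I ind] int_exp) auto
    also have "real (card I) * (- (l * (1 - \<epsilon> / 2) * \<mu>)) - - l * ((1 - \<epsilon>) * (card I * \<mu>))
        = - (card I * \<mu> * (\<epsilon> / 2) * l)"
      by (simp add: algebra_simps)
    also have "card I * \<mu> * (\<epsilon> / 2) * l = card I * \<mu> * \<epsilon>\<^sup>2 / (4 * b)"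
      by (simp add: l_def power2_eq_square)
    also have "{\<omega> \<in> space M. - l * ((1 - \<epsilon>) * (card I * \<mu>)) \<le> - l * (\<Sum>i\<in>I. Y i \<omega>)}
        = {\<omega> \<in> space M. (\<Sum>i\<in>I. Y i \<omega>) \<le> (1 - \<epsilon>) * (card I * \<mu>)}"
      using l by (auto simp: mult_le_cancel_left)
    finally show "prob {\<omega> \<in> space M. (\<Sum>i\<in>I. Y i \<omega>) \<le> (1 - \<epsilon>) * (card I * \<mu>)} \<le> exp (- (card I * \<mu> * \<epsilon>\<^sup>2 / (4 * b)))" .
  }
  {
    assume E: "\<And>i. i \<in> I \<Longrightarrow> expectation (Y i) \<le> \<mu>"
    have "expectation (\<lambda>\<omega>. exp (l * Y i \<omega>)) \<le> exp (l * (1 + \<epsilon> / 2) * \<mu>)" if i: "i \<in> I" for i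
    proof -
      have "expectation (\<lambda>\<omega>. exp (l * Y i \<omega>)) \<le> expectation (\<lambda>\<omega>. 1 + l * (1 + \<epsilon> / 2) * Y i \<omega>)"
      proof (rule integral_mono[OF int_exp[OF i]])
        fix \<omega>
        show "exp (l * Y i \<omega>) \<le> 1 + l * (1 + \<epsilon> / 2) * Y i \<omega>"
          using exp_bound[OF ly(1,2)[OF i, of \<omega>]] ly(3)[OF i, of \<omega>]
          by (simp add: algebra_simps)
      qed (use int i in auto)
      also have "\<dots> = 1 + l * (1 + \<epsilon> / 2) * expectation (Y i)"
        using int[OF i] by (simp add: prob_space)
      also have "\<dots> \<le> 1 + l * (1 + \<epsilon> / 2) * \<mu>"
        using E[OF i] l \<epsilon> by (simp add: mult_left_mono)
      also have "\<dots> \<le> exp (l * (1 + \<epsilon> / 2) * \<mu>)"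
        using exp_ge_add_one_self[of "l * (1 + \<epsilon> / 2) * \<mu>"] by simp
      finally show ?thesis .
    qed
    then have "prob {\<omega> \<in> space M. l * ((1 + \<epsilon>) * (card I * \<mu>)) \<le> l * (\<Sum>i\<in>I. Y i \<omega>)}
        \<le> exp (real (card I) * (l * (1 + \<epsilon> / 2) * \<mu>) - l * ((1 + \<epsilon>) * (card I * \<mu>)))"
      by (intro Laplace_sum_tail[OF I ind] int_exp) auto
    also have "real (card I) * (l * (1 + \<epsilon> / 2) * \<mu>) - l * ((1 + \<epsilon>) * (card I * \<mu>))
        = - (card I * \<mu> * (\<epsilon> / 2) * l)"
      by (simp add: algebra_simps)
    also have "card I * \<mu> * (\<epsilon> / 2) * l = card I * \<mu> * \<epsilon>\<^sup>2 / (4 * b)"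
      by (simp add: l_def power2_eq_square)
    also have "{\<omega> \<in> space M. l * ((1 + \<epsilon>) * (card I * \<mu>)) \<le> l * (\<Sum>i\<in>I. Y i \<omega>)}
        = {\<omega> \<in> space M. (1 + \<epsilon>) * (card I * \<mu>) \<le> (\<Sum>i\<in>I. Y i \<omega>)}"
      using l by (auto simp: mult_le_cancel_left)
    finally show "prob {\<omega> \<in> space M. (1 + \<epsilon>) * (card I * \<mu>) \<le> (\<Sum>i\<in>I. Y i \<omega>)} \<le> exp (- (card I * \<mu> * \<epsilon>\<^sup>2 / (4 * b)))" .
  }
qed

text \<open>A Poisson-type tail, meant for counts far above their mean. The parameter
  \<open>l\<close> stays free because means of constant order and means tending to zero call for
  different choices.\<close>

lemma prob_count_cauchy_ge:
  assumes I: "finite I" and ind: "indep_vars (\<lambda>_. borel) X I"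
    and X: "\<And>i. i \<in> I \<Longrightarrow> distributed M lborel (X i) cauchy_density"
    and \<tau>: "0 < \<tau>" and l: "0 < l"
  shows "prob {\<omega> \<in> space M. m \<le> real (card {i \<in> I. \<tau> \<le> \<bar>X i \<omega>\<bar>})}
    \<le> exp (card I * (exp l * (2 / (pi * \<tau>))) - l * m)"
proof -
  define Y where "Y i \<omega> = indicat_real {\<tau>..} \<bar>X i \<omega>\<bar>" for i \<omega>
  have [measurable]: "X i \<in> borel_measurable M" if "i \<in> I" for i
    using ind that by (auto simp: indep_vars_def)
  have indY: "indep_vars (\<lambda>_. borel) Y I"
    unfolding Y_def by (rule indep_vars_compose2[OF ind, where Y="\<lambda>_ x. indicator {\<tau>..} \<bar>x\<bar>"]) auto
  have count: "real (card {i \<in> I. \<tau> \<le> \<bar>X i \<omega>\<bar>}) = (\<Sum>i\<in>I. Y i \<omega>)" for \<omega>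
    using I by (simp add: Y_def indicator_def sum.If_cases Int_def)
  have Yexp: "exp (l * Y i \<omega>) = 1 + (exp l - 1) * Y i \<omega>" for i \<omega>
    by (simp add: Y_def split: split_indicator)
  have intY: "integrable M (Y i)" if "i \<in> I" for i
    by (rule integrable_const_bound[where B=1]) (use that indY in \<open>auto simp: Y_def indep_vars_def\<close>)
  have EY: "expectation (Y i) \<le> 2 / (pi * \<tau>)" if i: "i \<in> I" for i
  proof -
    have "expectation (Y i) = expectation (indicat_real {\<omega> \<in> space M. \<tau> \<le> \<bar>X i \<omega>\<bar>})"
      by (intro Bochner_Integration.integral_cong) (auto simp: Y_def split: split_indicator)
    also have "\<dots> = prob {\<omega> \<in> space M. \<tau> \<le> \<bar>X i \<omega>\<bar>}"
    proof -
      have [measurable]: "X i \<in> borel_measurable M"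
        using distributed_measurable[OF X[OF i]] by simp
      have "{\<omega> \<in> space M. \<tau> \<le> \<bar>X i \<omega>\<bar>} \<in> events" by measurable
      then show ?thesis by (simp add: Int_absorb2 sets.sets_into_space)
    qed
    also have "\<dots> \<le> 2 / (pi * \<tau>)"
      by (rule prob_cauchy_tail[OF X[OF i] \<tau>])
    finally show ?thesis .
  qed
  have "expectation (\<lambda>\<omega>. exp (l * Y i \<omega>)) \<le> exp (exp l * (2 / (pi * \<tau>)))" if i: "i \<in> I" for i
  proof -
    have "expectation (\<lambda>\<omega>. exp (l * Y i \<omega>)) = 1 + (exp l - 1) * expectation (Y i)"
      unfolding Yexp using intY[OF i] by (simp add: prob_space)
    also have "\<dots> \<le> 1 + exp l * (2 / (pi * \<tau>))"
    proof -
      have "(exp l - 1) * expectation (Y i) \<le> exp l * (2 / (pi * \<tau>))"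
        using l EY[OF i] \<tau> by (intro mult_mono) (auto intro: integral_nonneg simp: Y_def)
      then show ?thesis by simp
    qed
    also have "\<dots> \<le> exp (exp l * (2 / (pi * \<tau>)))"
      by (rule exp_ge_add_one_self)
    finally show ?thesis .
  qed
  then have "prob {\<omega> \<in> space M. l * m \<le> l * (\<Sum>i\<in>I. Y i \<omega>)} \<le> exp (card I * (exp l * (2 / (pi * \<tau>))) - l * m)"
    by (intro Laplace_sum_tail[OF I indY]) (auto simp: Yexp intY)
  then show ?thesis
    using l by (simp add: count)
qed

text \<open>The bound is uniform in the shift \<open>t\<close> and in the coefficients. Dividing the
  combination by its scale \<sigma>, which is at least 1, gives a standard Cauchy variable that is
  no larger in absolute value and whose truncated mean is known.\<close>

lemma expectation_min_cauchy_linear_combination: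
  assumes fin: "finite I" and ind: "indep_vars (\<lambda>_. borel) X I"
    and X: "\<And>i. i \<in> I \<Longrightarrow> distributed M lborel (X i) cauchy_density"
    and c: "1 \<le> (\<Sum>i\<in>I. \<bar>c i\<bar>)" and T: "0 < T"
  shows "2 / pi * ln (T / 2) \<le> expectation (\<lambda>\<omega>. min \<bar>t + (\<Sum>i\<in>I. c i * X i \<omega>)\<bar> T)"
proof -
  define \<sigma> where "\<sigma> = (\<Sum>i\<in>I. \<bar>c i\<bar>)"
  define W where "W \<omega> = (\<Sum>i\<in>I. c i * X i \<omega>)" for \<omega>
  have \<sigma>: "1 \<le> \<sigma>" using c by (simp add: \<sigma>_def)
  have W: "distributed M lborel W (scaled_cauchy_density \<sigma>)"
    unfolding W_def \<sigma>_def using c by (intro distributed_cauchy_linear_combination[OF fin ind X]) auto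
  have mW: "distributed M lborel (\<lambda>\<omega>. - W \<omega>) (scaled_cauchy_density \<sigma>)"
    using distributed_scaled_cauchy_cmult[OF W, of "-1"] \<sigma> by simp
  have sW: "distributed M lborel (\<lambda>\<omega>. (1 / \<sigma>) * W \<omega>) cauchy_density"
    using distributed_scaled_cauchy_cmult[OF W, of "1 / \<sigma>"] \<sigma> by (simp add: scaled_cauchy_density_one)
  have [measurable]: "W \<in> borel_measurable M"
    using distributed_measurable[OF W] by simp
  have int: "integrable M (\<lambda>\<omega>. min \<bar>f \<omega>\<bar> T)" if [measurable]: "f \<in> borel_measurable M" for f
    by (rule integrable_const_bound[where B=T]) (use T in auto)
  have sym: "expectation (\<lambda>\<omega>. min \<bar>t + W \<omega>\<bar> T) = expectation (\<lambda>\<omega>. min \<bar>t + - W \<omega>\<bar> T)"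
    using distributed_integral[OF W, of "\<lambda>x. min \<bar>t + x\<bar> T"] distributed_integral[OF mW, of "\<lambda>x. min \<bar>t + x\<bar> T"]
      \<sigma> by (simp add: scaled_cauchy_density_nonneg)
  have "2 * ln (T / 2) \<le> ln (1 + (T / 2)\<^sup>2) - ln (1 + 0\<^sup>2)"
  proof -
    have "2 * ln (T / 2) = ln ((T / 2)\<^sup>2)"
      using T by (simp add: ln_realpow)
    also have "\<dots> \<le> ln (1 + (T / 2)\<^sup>2)"
      using T by (subst ln_le_cancel_iff) (auto simp: add_pos_nonneg)
    finally show ?thesis by simp
  qed
  then have "2 / pi * ln (T / 2) \<le> (ln (1 + (T / 2)\<^sup>2) - ln (1 + 0\<^sup>2)) / pi"
    using divide_right_mono[of _ _ pi] by fastforce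
  also have "\<dots> = expectation (\<lambda>\<omega>. abs_within 0 (T / 2) ((1 / \<sigma>) * W \<omega>))"
    using T by (intro expectation_cauchy_abs_within[OF sW, symmetric]) auto
  \<comment> \<open>\<open>W\<close> is symmetric, and averaging over \<open>\<plusminus>W\<close> removes the shift \<open>t\<close>:
    \<open>min \<bar>t + W\<bar> T + min \<bar>t - W\<bar> T \<ge> min (2 \<bar>W\<bar>) T\<close>.\<close>
  also have "\<dots> \<le> expectation (\<lambda>\<omega>. (min \<bar>t + W \<omega>\<bar> T + min \<bar>t + - W \<omega>\<bar> T) / 2)"
  proof (rule integral_mono)
    fix \<omega>
    have "\<bar>(1 / \<sigma>) * W \<omega>\<bar> \<le> \<bar>W \<omega>\<bar>"
      using \<sigma> mult_right_mono[OF \<sigma>, of "\<bar>W \<omega>\<bar>"] by (simp add: abs_mult field_simps)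
    then have "abs_within 0 (T / 2) ((1 / \<sigma>) * W \<omega>) \<le> min \<bar>W \<omega>\<bar> (T / 2)"
      using T by (auto simp: abs_within_def)
    then show "abs_within 0 (T / 2) ((1 / \<sigma>) * W \<omega>) \<le> (min \<bar>t + W \<omega>\<bar> T + min \<bar>t + - W \<omega>\<bar> T) / 2"
      using T by (auto simp: min_def split: if_splits)
  next
    show "integrable M (\<lambda>\<omega>. abs_within 0 (T / 2) (1 / \<sigma> * W \<omega>))"
      by (rule integrable_const_bound[where B="T / 2"]) (use T in \<open>auto simp: abs_within_def\<close>)
  qed (use int in \<open>auto intro!: Bochner_Integration.integrable_divide Bochner_Integration.integrable_add\<close>)
  also have "\<dots> = expectation (\<lambda>\<omega>. min \<bar>t + W \<omega>\<bar> T)"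
    using int[of "\<lambda>\<omega>. t + W \<omega>"] int[of "\<lambda>\<omega>. t + - W \<omega>"] sym by simp
  finally show ?thesis unfolding W_def .
qed

end

section \<open>Residuals of a fixed matrix\<close>

text \<open>By homogeneity the coefficients may be divided by their norm \<open>s\<close>. They are
  then rounded to multiples of \<open>1 / N\<close> and the shift to an integer. In each row this
  changes the combination by at most \<open>k * B / N\<close> and the shift by at most 1.\<close>

lemma sum_shifted_ge_of_grid:
  fixes D :: "nat \<Rightarrow> nat \<Rightarrow> real" and x :: "nat \<Rightarrow> real" and t B A s :: real and N n k :: nat
  assumes N: "0 < N"
    and B: "\<And>i j. i < n \<Longrightarrow> j < n \<Longrightarrow> \<bar>D i j\<bar> \<le> B"
    and grid: "\<And>p q t'. inj_on p {..<k} \<Longrightarrow> p \<in> {..<k} \<rightarrow> {..<n} \<Longrightarrow> q \<in> {..<k} \<rightarrow> {- int N..int N} \<Longrightarrow>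
        t' \<in> {- int (2 * n)..int (2 * n)} \<Longrightarrow> real N \<le> (\<Sum>l<k. \<bar>real_of_int (q l)\<bar>) \<Longrightarrow>
        A \<le> (\<Sum>i<n. \<bar>real_of_int t' + (\<Sum>l<k. real_of_int (q l) / N * D i (p l))\<bar>)"
    and p: "inj_on p {..<k}" "p \<in> {..<k} \<rightarrow> {..<n}"
    and s: "s = (\<Sum>l<k. \<bar>x l\<bar>)" "0 < s"
    and t: "\<bar>t\<bar> \<le> 2 * n * s"
  shows "s * (A - n * (k * B / N + 1)) \<le> (\<Sum>i<n. \<bar>t + (\<Sum>l<k. x l * D i (p l))\<bar>)"
proof -
  \<comment> \<open>Rounding away from zero: the rounded coefficients still have norm at least 1, as
    the hypothesis \<open>grid\<close> demands.\<close>
  define q :: "nat \<Rightarrow> int" where "q l = (if 0 \<le> x l then \<lceil>N * (\<bar>x l\<bar> / s)\<rceil> else - \<lceil>N * (\<bar>x l\<bar> / s)\<rceil>)" for l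
  define t' where "t' = \<lfloor>t / s\<rfloor>"
  have xs: "\<bar>x l\<bar> / s \<le> 1" if "l < k" for l
    using s member_le_sum[of l "{..<k}" "\<lambda>l. \<bar>x l\<bar>"] that by simp
  have absq: "\<bar>q l\<bar> = \<lceil>N * (\<bar>x l\<bar> / s)\<rceil>" for l
  proof -
    have "0 \<le> N * (\<bar>x l\<bar> / s)" using s by simp
    then have "0 \<le> \<lceil>N * (\<bar>x l\<bar> / s)\<rceil>" by linarith
    then show ?thesis by (simp add: q_def)
  qed
  have q: "q \<in> {..<k} \<rightarrow> {- int N..int N}"
  proof
    fix l assume "l \<in> {..<k}"
    then have "real N * (\<bar>x l\<bar> / s) \<le> real N * 1" using xs by (intro mult_left_mono) auto
    then have "\<bar>q l\<bar> \<le> int N" unfolding absq by (simp add: ceiling_le_iff)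
    then show "q l \<in> {- int N..int N}" by auto
  qed
  have sumq: "real N \<le> (\<Sum>l<k. \<bar>real_of_int (q l)\<bar>)"
  proof -
    have "real N = (\<Sum>l<k. N * (\<bar>x l\<bar> / s))"
      using s by (simp add: sum_distrib_left[symmetric] sum_divide_distrib[symmetric])
    also have "\<dots> \<le> (\<Sum>l<k. real_of_int \<bar>q l\<bar>)"
      unfolding absq by (intro sum_mono) simp
    finally show ?thesis by simp
  qed
  have t': "t' \<in> {- int (2 * n)..int (2 * n)}"
  proof -
    have "\<bar>t / s\<bar> \<le> 2 * n" using t s by (simp add: field_simps)
    then have "- real (2 * n) \<le> t / s" "t / s \<le> real (2 * n)"
      by (simp_all only: abs_le_iff of_nat_mult) auto
    then show ?thesis unfolding t'_def by (auto simp: le_floor_iff floor_le_iff)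
  qed
  have qx: "\<bar>real_of_int (q l) / N - x l / s\<bar> \<le> 1 / N" for l
  proof -
    have "\<bar>real_of_int (q l) - N * (x l / s)\<bar> \<le> 1"
      unfolding q_def using s by auto linarith+
    then have "\<bar>real_of_int (q l) - N * (x l / s)\<bar> / N \<le> 1 / N"
      by (intro divide_right_mono) auto
    also have "\<bar>real_of_int (q l) - N * (x l / s)\<bar> / N = \<bar>(real_of_int (q l) - N * (x l / s)) / N\<bar>"
      by simp
    also have "(real_of_int (q l) - N * (x l / s)) / N = real_of_int (q l) / N - x l / s"
      using N by (simp add: diff_divide_distrib)
    finally show ?thesis .
  qed
  have "A \<le> (\<Sum>i<n. \<bar>real_of_int t' + (\<Sum>l<k. real_of_int (q l) / N * D i (p l))\<bar>)"
    by (rule grid[OF p q t' sumq])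
  also have "\<dots> \<le> (\<Sum>i<n. \<bar>t + (\<Sum>l<k. x l * D i (p l))\<bar> / s + (k * B / N + 1))"
  proof (rule sum_mono)
    fix i assume i: "i \<in> {..<n}"
    have "(\<Sum>l<k. real_of_int (q l) / N * D i (p l))
        = (\<Sum>l<k. x l * D i (p l)) / s + (\<Sum>l<k. (real_of_int (q l) / N - x l / s) * D i (p l))"
      by (simp add: sum_divide_distrib sum.distrib[symmetric] algebra_simps)
    then have eq: "real_of_int t' + (\<Sum>l<k. real_of_int (q l) / N * D i (p l))
        = (t + (\<Sum>l<k. x l * D i (p l))) / s + (t' - t / s)
          + (\<Sum>l<k. (real_of_int (q l) / N - x l / s) * D i (p l))"
      by (simp add: add_divide_distrib)
    have "\<bar>\<Sum>l<k. (real_of_int (q l) / N - x l / s) * D i (p l)\<bar> \<le> (\<Sum>l<k. 1 / N * B)" (is "\<bar>?e\<bar> \<le> _")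
      using i p(2) unfolding abs_mult
      by (intro order_trans[OF sum_abs] sum_mono) (auto simp: abs_mult simp del: times_divide_eq_left intro!: mult_mono qx B)
    moreover have "\<bar>t' - t / s\<bar> \<le> 1"
      unfolding t'_def by linarith
    moreover have "\<bar>(t + (\<Sum>l<k. x l * D i (p l))) / s\<bar> = \<bar>t + (\<Sum>l<k. x l * D i (p l))\<bar> / s"
      using s(2) by (simp add: abs_divide)
    ultimately show "\<bar>real_of_int t' + (\<Sum>l<k. real_of_int (q l) / N * D i (p l))\<bar>
        \<le> \<bar>t + (\<Sum>l<k. x l * D i (p l))\<bar> / s + (k * B / N + 1)"
      unfolding eq using abs_triangle_ineq[of "(t + (\<Sum>l<k. x l * D i (p l))) / s" "t' - t / s"]
        abs_triangle_ineq[of "(t + (\<Sum>l<k. x l * D i (p l))) / s + (t' - t / s)" ?e]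
      by (simp only: sum_constant card_lessThan) (simp add: algebra_simps)
  qed
  also have "\<dots> = (\<Sum>i<n. \<bar>t + (\<Sum>l<k. x l * D i (p l))\<bar>) / s + n * (k * B / N + 1)"
    by (simp add: sum.distrib sum_divide_distrib)
  finally have "A - n * (k * B / N + 1) \<le> (\<Sum>i<n. \<bar>t + (\<Sum>l<k. x l * D i (p l))\<bar>) / s"
    by simp
  then show ?thesis
    using s(2) by (simp add: pos_le_divide_eq mult.commute)
qed

section \<open>Cost of a single column\<close>

lemma abs_linear_combination_le:
  fixes x d :: "nat \<Rightarrow> real"
  assumes "\<And>l. l < k \<Longrightarrow> \<bar>d l\<bar> \<le> c"
  shows "\<bar>\<Sum>l<k. x l * d l\<bar> \<le> c * (\<Sum>l<k. \<bar>x l\<bar>)"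
proof -
  have "\<bar>\<Sum>l<k. x l * d l\<bar> \<le> (\<Sum>l<k. \<bar>x l\<bar> * c)"
    using assms by (intro order_trans[OF sum_abs] sum_mono) (auto simp: abs_mult intro!: mult_left_mono)
  then show ?thesis by (simp add: sum_distrib_left mult.commute)
qed

text \<open>
  Here \<open>p\<close> lists the columns in \<open>S\<close> followed by the column \<open>p r\<close> that is approximated, and
  \<open>b\<close> is the mass of the large entries of that column outside the rows spoiled by \<open>S\<close>.
\<close>

lemma column_cost_ge:
  fixes D :: "nat \<Rightarrow> nat \<Rightarrow> real" and x :: "nat \<Rightarrow> real" and p :: "nat \<Rightarrow> nat"
    and A\<^sub>1 a m u w \<eta> :: real and m' n r :: nat
  assumes A1: "\<And>(x :: nat \<Rightarrow> real) t :: real. 0 < (\<Sum>l<Suc r. \<bar>x l\<bar>) \<Longrightarrow> \<bar>t\<bar> \<le> 2 * n * (\<Sum>l<Suc r. \<bar>x l\<bar>) \<Longrightarrow>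
        (\<Sum>l<Suc r. \<bar>x l\<bar>) * A\<^sub>1 \<le> (\<Sum>i<n. \<bar>t + (\<Sum>l<Suc r. x l * D i (p l))\<bar>)"
    and p: "p \<in> {..<Suc r} \<rightarrow> {..<n}"
    and m: "\<And>j. j < n \<Longrightarrow> real (card {i \<in> {..<n}. n \<le> \<bar>D i j\<bar>}) \<le> m" "2 * (Suc r * m) \<le> n"
    and m': "\<And>j. j < n \<Longrightarrow> card {i \<in> {..<n}. u \<le> \<bar>D i j\<bar>} \<le> m'" "6 * m' \<le> n" "3 * m' * n \<le> A\<^sub>1"
    and \<eta>: "0 < \<eta>"
    and a: "a * (1 + 2 * n / \<eta>) \<le> 2 * A\<^sub>1" "2 * a \<le> n\<^sup>2" "4 * a \<le> u" "0 < n"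
  defines "b \<equiv> (\<Sum>i | i < n \<and> (\<forall>l<r. \<bar>D i (p l)\<bar> < n). abs_within u w (D i (p r)))"
  shows "a + b / 4 \<le> (\<Sum>i<n. \<bar>\<eta> * ((\<Sum>l<r. x l) - 1) + (\<Sum>l<r. x l * D i (p l)) - D i (p r)\<bar>)"
proof -
  \<comment> \<open>With the coefficient -1 for the approximated column, the residual becomes a
    shifted combination of \<open>Suc r\<close> columns whose coefficient norm \<open>s\<close> is
    at least 1.\<close>
  define x' where "x' l = (if l < r then x l else -1)" for l
  define t where "t = \<eta> * ((\<Sum>l<r. x l) - 1)"
  define s where "s = (\<Sum>l<Suc r. \<bar>x' l\<bar>)"
  define C where "C = (\<Sum>i<n. \<bar>t + (\<Sum>l<Suc r. x' l * D i (p l))\<bar>)"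
  define G where "G = {i \<in> {..<n}. \<forall>l<Suc r. \<bar>D i (p l)\<bar> < n}"
  define E where "E = {i \<in> {..<n}. (\<forall>l<r. \<bar>D i (p l)\<bar> < n) \<and> u \<le> \<bar>D i (p r)\<bar> \<and> \<bar>D i (p r)\<bar> \<le> w}"
  have y: "t + (\<Sum>l<Suc r. x' l * D i (p l)) = t + (\<Sum>l<r. x l * D i (p l)) - D i (p r)" for i
    by (simp add: x'_def)
  have C: "C = (\<Sum>i<n. \<bar>\<eta> * ((\<Sum>l<r. x l) - 1) + (\<Sum>l<r. x l * D i (p l)) - D i (p r)\<bar>)"
    unfolding C_def y by (simp add: t_def)
  have s_eq: "s = (\<Sum>l<r. \<bar>x l\<bar>) + 1"
    by (simp add: s_def x'_def)
  then have s1: "1 \<le> s" by (simp add: sum_nonneg)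
  have pr: "p r < n" using p by auto
  have small: "s * A\<^sub>1 \<le> C" if "\<bar>t\<bar> \<le> 2 * n * s"
    using A1[of x' t] that s1 unfolding s_def[symmetric] C_def by simp
  \<comment> \<open>In the rows of \<open>G\<close> the combination is at most n s, which is less
    than half of the shift. The count hypothesis \<open>m\<close> makes these at least half of all
    rows.\<close>
  have large: "n * \<bar>t\<bar> / 4 \<le> C" if t: "2 * n * s < \<bar>t\<bar>"
  proof -
    have "real (card ({..<n} - G)) \<le> Suc r * m"
    proof -
      have "{..<n} - G = (\<Union>l<Suc r. {i \<in> {..<n}. n \<le> \<bar>D i (p l)\<bar>})"
        unfolding G_def by (auto simp: not_less simp del: lessThan_Suc)
      then have "real (card ({..<n} - G)) \<le> (\<Sum>l<Suc r. real (card {i \<in> {..<n}. n \<le> \<bar>D i (p l)\<bar>}))"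
        unfolding of_nat_sum[symmetric] of_nat_le_iff by (metis (no_types) card_UN_le finite_lessThan)
      also have "\<dots> \<le> (\<Sum>l<Suc r. m)"
        using p by (intro sum_mono m) auto
      finally show ?thesis by simp
    qed
    moreover have "G \<subseteq> {..<n}" by (auto simp: G_def)
    ultimately have "n / 2 \<le> card G"
      using m(2) by (simp add: card_Diff_subset finite_subset of_nat_diff card_mono[of "{..<n}", simplified])
    then have "n / 2 * (\<bar>t\<bar> / 2) \<le> card G * (\<bar>t\<bar> / 2)"
      by (intro mult_right_mono) auto
    also have "\<dots> = (\<Sum>i\<in>G. \<bar>t\<bar> / 2)" by simp
    also have "\<dots> \<le> (\<Sum>i\<in>G. \<bar>t + (\<Sum>l<Suc r. x' l * D i (p l))\<bar>)"
    proof (rule sum_mono)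
      fix i assume "i \<in> G"
      then have "\<bar>\<Sum>l<Suc r. x' l * D i (p l)\<bar> \<le> n * s"
        unfolding s_def by (intro abs_linear_combination_le) (auto simp: G_def)
      then show "\<bar>t\<bar> / 2 \<le> \<bar>t + (\<Sum>l<Suc r. x' l * D i (p l))\<bar>"
        using t by linarith
    qed
    also have "\<dots> \<le> C"
      unfolding C_def by (intro sum_mono2) (auto simp: G_def)
    finally show ?thesis by simp
  qed
  \<comment> \<open>For a small shift, \<eta> (2 - s) <= \<bar>t\<bar> <= 2 n s forces s (1 + 2 n /
    \<eta>) >= 2, so \<open>s * A\<^sub>1\<close> is almost \<open>2 * A\<^sub>1\<close>. For a
    large shift the cost is at least n^2 / 2.\<close>
  have aC: "a \<le> C"
  proof (cases "\<bar>t\<bar> \<le> 2 * n * s")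
    case True
    have "\<eta> * (2 - s) \<le> \<bar>t\<bar>"
    proof -
      have "(\<Sum>l<r. x l) \<le> s - 1"
        unfolding s_eq by (simp add: sum_mono)
      then have "2 - s \<le> \<bar>(\<Sum>l<r. x l) - 1\<bar>" by linarith
      then show ?thesis unfolding t_def using \<eta> by (simp add: abs_mult)
    qed
    then have "\<eta> * (2 - s) \<le> 2 * n * s" using True by simp
    then have "2 \<le> s * (1 + 2 * n / \<eta>)"
      using \<eta> by (simp add: field_simps)
    moreover have A1pos: "0 \<le> A\<^sub>1" using m'(3) by (metis of_nat_0_le_iff order_trans)
    ultimately have "2 * A\<^sub>1 \<le> s * (1 + 2 * n / \<eta>) * A\<^sub>1"
      by (rule mult_right_mono)
    then have "a * (1 + 2 * n / \<eta>) \<le> (s * A\<^sub>1) * (1 + 2 * n / \<eta>)"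
      using a(1) by (simp add: mult_ac)
    then have "a \<le> s * A\<^sub>1"
      using \<eta> by (subst (asm) mult_le_cancel_right_pos) (auto simp: add_pos_nonneg)
    then show ?thesis using small[OF True] by simp
  next
    case False
    then have "2 * n * 1 \<le> \<bar>t\<bar>"
      using s1 mult_left_mono[of 1 s "2 * n"] by linarith
    then have "real n * (2 * real n) / 4 \<le> n * \<bar>t\<bar> / 4"
      by (intro divide_right_mono mult_left_mono[of _ _ "real n"]) auto
    then show ?thesis
      using large False a(2) by (simp add: power2_eq_square)
  qed
  have finE: "finite E" by (simp add: E_def)
  have b_E: "b = (\<Sum>i\<in>E. \<bar>D i (p r)\<bar>)"
  proof -
    have "(\<Sum>i\<in>E. \<bar>D i (p r)\<bar>) = (\<Sum>i\<in>E. abs_within u w (D i (p r)))"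
      by (intro sum.cong) (auto simp: E_def abs_within_def)
    also have "\<dots> = b"
      unfolding b_def by (intro sum.mono_neutral_left) (auto simp: E_def abs_within_def)
    finally show ?thesis ..
  qed
  \<comment> \<open>In the rows of \<open>E\<close> the shift and the columns of \<open>S\<close>
    can cancel at most \<bar>t\<bar> + n s per row. There are at most \<open>m'\<close> such rows,
    and their total cancellation is itself at most \<open>C\<close>: by
    \<open>3 * m' * n \<le> A\<^sub>1\<close> for a small shift, by \<open>6 * m' \<le> n\<close>
    for a large one.\<close>
  have bC: "b \<le> 2 * C"
  proof -
    have cE: "card E \<le> m'"
      using m'(1)[OF pr] by (rule order_trans[rotated]) (auto intro!: card_mono simp: E_def)
    have "b - card E * (\<bar>t\<bar> + n * s) = (\<Sum>i\<in>E. \<bar>D i (p r)\<bar> - (\<bar>t\<bar> + n * s))"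
      by (simp add: b_E sum_subtractf)
    also have "\<dots> \<le> (\<Sum>i\<in>E. \<bar>t + (\<Sum>l<Suc r. x' l * D i (p l))\<bar>)"
    proof (rule sum_mono)
      fix i assume "i \<in> E"
      then have "\<bar>\<Sum>l<r. x l * D i (p l)\<bar> \<le> n * (\<Sum>l<r. \<bar>x l\<bar>)"
        by (intro abs_linear_combination_le) (auto simp: E_def)
      also have "\<dots> \<le> n * s"
        unfolding s_eq by (intro mult_left_mono) auto
      finally show "\<bar>D i (p r)\<bar> - (\<bar>t\<bar> + n * s) \<le> \<bar>t + (\<Sum>l<Suc r. x' l * D i (p l))\<bar>"
        unfolding y by linarith
    qed
    also have "\<dots> \<le> C"
      unfolding C_def by (intro sum_mono2) (auto simp: E_def)
    finally have 1: "b \<le> C + card E * (\<bar>t\<bar> + n * s)" by simp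
    have "card E * (\<bar>t\<bar> + n * s) \<le> m' * (\<bar>t\<bar> + n * s)"
      using cE s1 by (intro mult_right_mono) auto
    also have "\<dots> \<le> C"
    proof (cases "\<bar>t\<bar> \<le> 2 * n * s")
      case True
      then have "\<bar>t\<bar> + n * s \<le> 3 * n * s" by (simp add: mult_ac)
      then have "m' * (\<bar>t\<bar> + n * s) \<le> m' * (3 * n * s)"
        by (intro mult_left_mono) auto
      also have "\<dots> = s * (3 * m' * n)" by simp
      also have "\<dots> \<le> s * A\<^sub>1"
        using m'(3) s1 by (intro mult_left_mono) auto
      finally show ?thesis using small[OF True] by simp
    next
      case False
      then have "m' * (\<bar>t\<bar> + n * s) \<le> m' * (3 / 2 * \<bar>t\<bar>)"
        by (intro mult_left_mono) auto
      also have "\<dots> = (6 * m') * \<bar>t\<bar> / 4" by simp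
      also have "\<dots> \<le> n * \<bar>t\<bar> / 4"
        using m'(2) by (intro divide_right_mono mult_right_mono) (auto simp flip: of_nat_mult)
      finally show ?thesis using large False by simp
    qed
    finally show ?thesis using 1 by simp
  qed
  \<comment> \<open>The two lower bounds combine additively although both concern the same cost: a
    single entry in \<open>E\<close> already gives b >= u >= 4 a, hence a + b / 4 <= b / 2 <=
    C.\<close>
  show ?thesis
  proof (cases "E = {}")
    case True
    then show ?thesis using aC C b_E by simp
  next
    case False
    then obtain i where i: "i \<in> E" by auto
    have "u \<le> \<bar>D i (p r)\<bar>" using i by (simp add: E_def)
    also have "\<dots> \<le> b"
      unfolding b_E using i finE by (intro member_le_sum) auto
    finally have "4 * a \<le> b" using a(3) by simp
    then show ?thesis using bC C by simp
  qed
qed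

section \<open>From columns to the whole matrix\<close>

lemma shifted_mat_carrier: "D \<in> carrier_mat n n \<Longrightarrow> shifted_mat n \<eta> D \<in> carrier_mat n n"
  by (simp add: shifted_mat_def ones_col_def)

lemma index_shifted_mat:
  assumes "D \<in> carrier_mat n n" "i < n" "j < n"
  shows "shifted_mat n \<eta> D $$ (i, j) = \<eta> + D $$ (i, j)"
  using assms by (simp add: shifted_mat_def ones_col_def scalar_prod_def)

lemma col_submatrix_carrier:
  assumes "A \<in> carrier_mat n n'" "S \<subseteq> {..<n'}"
  shows "col_submatrix A S \<in> carrier_mat n (card S)"
proof -
  have "{j. j < n' \<and> j \<in> S} = S" using assms by auto
  then show ?thesis using assms by (auto simp: col_submatrix_def dim_submatrix)
qed

lemma index_col_submatrix:
  assumes "A \<in> carrier_mat n n'" "S \<subseteq> {..<n'}" "i < n" "l < card S"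
  shows "col_submatrix A S $$ (i, l) = A $$ (i, pick S l)"
proof -
  have "{j. j < n' \<and> j \<in> S} = S" using assms by auto
  then show ?thesis
    using assms by (simp add: col_submatrix_def submatrix_index pick_UNIV)
qed

lemma pick_lt:
  assumes "S \<subseteq> {..<n}" "l < card S"
  shows "pick S l < n"
  using pick_in_set_le[OF assms(2)] assms(1) by auto

lemma inj_on_pick: "inj_on (pick S) {..<card S}"
  by (rule inj_onI) (metis lessThan_iff nat_neq_iff pick_mono_le)

lemma l1_norm_residual:
  assumes D: "D \<in> carrier_mat n n" and S: "S \<subseteq> {..<n}" "card S = r" and X: "X \<in> carrier_mat r n"
  shows "l1_norm_mat (col_submatrix (shifted_mat n \<eta> D) S * X - shifted_mat n \<eta> D)
    = (\<Sum>j<n. \<Sum>i<n. \<bar>\<eta> * ((\<Sum>l<r. X $$ (l, j)) - 1) + (\<Sum>l<r. X $$ (l, j) * D $$ (i, pick S l)) - D $$ (i, j)\<bar>)"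
proof -
  note A = shifted_mat_carrier[OF D, of \<eta>]
  note C = col_submatrix_carrier[OF A S(1)]
  have "(col_submatrix (shifted_mat n \<eta> D) S * X - shifted_mat n \<eta> D) $$ (i, j)
      = \<eta> * ((\<Sum>l<r. X $$ (l, j)) - 1) + (\<Sum>l<r. X $$ (l, j) * D $$ (i, pick S l)) - D $$ (i, j)"
    if ij: "i < n" "j < n" for i j
  proof -
    have "(col_submatrix (shifted_mat n \<eta> D) S * X) $$ (i, j)
        = (\<Sum>l<r. col_submatrix (shifted_mat n \<eta> D) S $$ (i, l) * X $$ (l, j))"
      using C X S(2) ij by (simp add: scalar_prod_def atLeast0LessThan)
    also have "\<dots> = (\<Sum>l<r. (\<eta> + D $$ (i, pick S l)) * X $$ (l, j))"
      using S ij by (intro sum.cong) (auto simp: index_col_submatrix[OF A] index_shifted_mat[OF D] pick_lt)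
    also have "\<dots> = \<eta> * (\<Sum>l<r. X $$ (l, j)) + (\<Sum>l<r. X $$ (l, j) * D $$ (i, pick S l))"
      by (simp add: sum.distrib[symmetric] sum_distrib_left algebra_simps)
    finally show ?thesis
      using A C X ij by (simp add: index_shifted_mat[OF D] algebra_simps)
  qed
  moreover have "dim_row (col_submatrix (shifted_mat n \<eta> D) S * X - shifted_mat n \<eta> D) = n"
    "dim_col (col_submatrix (shifted_mat n \<eta> D) S * X - shifted_mat n \<eta> D) = n"
    using A by auto
  ultimately show ?thesis
    unfolding l1_norm_mat_def by (subst sum.swap) simp
qed

text \<open>Sums the column bound over the columns outside \<open>S\<close>; those in
  \<open>S\<close> are bounded below by zero. From the mass \<open>V\<close> of large entries one
  loses the \<open>r\<close> columns of \<open>S\<close> and at most \<open>r * m\<close> spoiled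
  rows. Each lost line carries at most \<open>m' * w\<close>. \<open>A\<^sub>1\<close> is the grid
  bound \<open>A\<close> reduced by the rounding error.\<close>

lemma css_l1_cost_ge:
  fixes \<Delta> :: "real mat" and A A\<^sub>1 B a m u w \<eta> V :: real and N n r m' :: nat
  assumes \<Delta>: "\<Delta> \<in> carrier_mat n n" and S: "S \<subseteq> {..<n}" "card S = r"
    and N: "0 < N"
    and B: "\<And>i j. i < n \<Longrightarrow> j < n \<Longrightarrow> \<bar>\<Delta> $$ (i, j)\<bar> \<le> B"
    and V: "V \<le> (\<Sum>i<n. \<Sum>j<n. abs_within u w (\<Delta> $$ (i, j)))"
    and grid: "\<And>p q t'. inj_on p {..<Suc r} \<Longrightarrow> p \<in> {..<Suc r} \<rightarrow> {..<n} \<Longrightarrow> q \<in> {..<Suc r} \<rightarrow> {- int N..int N} \<Longrightarrow>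
        t' \<in> {- int (2 * n)..int (2 * n)} \<Longrightarrow> real N \<le> (\<Sum>l<Suc r. \<bar>real_of_int (q l)\<bar>) \<Longrightarrow>
        A \<le> (\<Sum>i<n. \<bar>real_of_int t' + (\<Sum>l<Suc r. real_of_int (q l) / N * \<Delta> $$ (i, p l))\<bar>)"
    and m: "\<And>j. j < n \<Longrightarrow> real (card {i \<in> {..<n}. n \<le> \<bar>\<Delta> $$ (i, j)\<bar>}) \<le> m" "2 * (Suc r * m) \<le> n"
    and m'_col: "\<And>j. j < n \<Longrightarrow> card {i \<in> {..<n}. u \<le> \<bar>\<Delta> $$ (i, j)\<bar>} \<le> m'"
    and m'_row: "\<And>i. i < n \<Longrightarrow> card {j \<in> {..<n}. u \<le> \<bar>\<Delta> $$ (i, j)\<bar>} \<le> m'"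
    and m': "6 * m' \<le> n"
    and \<eta>: "0 < \<eta>" and w: "0 \<le> w"
    and a: "2 * a \<le> n\<^sup>2" "4 * a \<le> u" "0 < n"
  defines "A\<^sub>1 \<equiv> A - n * (Suc r * B / N + 1)"
  assumes A\<^sub>1: "3 * m' * n \<le> A\<^sub>1" "a * (1 + 2 * n / \<eta>) \<le> 2 * A\<^sub>1"
  shows "(real n - r) * a + (V - (r * (m' * w) + r * m * (m' * w))) / 4 \<le> css_l1_cost (shifted_mat n \<eta> \<Delta>) S"
proof -
  define W where "W i j = abs_within u w (\<Delta> $$ (i, j))" for i j
  define G where "G = {i \<in> {..<n}. \<forall>l<r. \<bar>\<Delta> $$ (i, pick S l)\<bar> < n}"
  have finS: "finite S" using S(1) finite_subset by blast
  have W0: "0 \<le> W i j" for i j using w by (simp add: W_def abs_within_bounds)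
  have colW: "(\<Sum>i<n. W i j) \<le> m' * w" if "j < n" for j
  proof -
    have "(\<Sum>i<n. W i j) = (\<Sum>i\<in>{i \<in> {..<n}. u \<le> \<bar>\<Delta> $$ (i, j)\<bar>}. W i j)"
      by (intro sum.mono_neutral_right) (auto simp: W_def abs_within_def)
    also have "\<dots> \<le> card {i \<in> {..<n}. u \<le> \<bar>\<Delta> $$ (i, j)\<bar>} * w"
      using w by (intro sum_bounded_above) (auto simp: W_def abs_within_bounds)
    also have "\<dots> \<le> m' * w" using m'_col[OF that] w by (intro mult_right_mono) auto
    finally show ?thesis .
  qed
  have rowW: "(\<Sum>j<n. W i j) \<le> m' * w" if "i < n" for i
  proof -
    have "(\<Sum>j<n. W i j) = (\<Sum>j\<in>{j \<in> {..<n}. u \<le> \<bar>\<Delta> $$ (i, j)\<bar>}. W i j)"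
      by (intro sum.mono_neutral_right) (auto simp: W_def abs_within_def)
    also have "\<dots> \<le> card {j \<in> {..<n}. u \<le> \<bar>\<Delta> $$ (i, j)\<bar>} * w"
      using w by (intro sum_bounded_above) (auto simp: W_def abs_within_bounds)
    also have "\<dots> \<le> m' * w" using m'_row[OF that] w by (intro mult_right_mono) auto
    finally show ?thesis .
  qed
  have badG: "real (card ({..<n} - G)) \<le> r * m"
  proof -
    have "{..<n} - G = (\<Union>l<r. {i \<in> {..<n}. n \<le> \<bar>\<Delta> $$ (i, pick S l)\<bar>})"
      unfolding G_def by (auto simp: not_less)
    then have "real (card ({..<n} - G)) \<le> (\<Sum>l<r. real (card {i \<in> {..<n}. n \<le> \<bar>\<Delta> $$ (i, pick S l)\<bar>}))"
      unfolding of_nat_sum[symmetric] of_nat_le_iff by (metis (no_types) card_UN_le finite_lessThan)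
    also have "\<dots> \<le> (\<Sum>l<r. m)"
      using pick_lt[OF S(1)] S(2) by (intro sum_mono m) auto
    finally show ?thesis by simp
  qed
  have VW: "V - (r * (m' * w) + r * m * (m' * w)) \<le> (\<Sum>j\<in>{..<n} - S. \<Sum>i\<in>G. W i j)"
  proof -
    have "V \<le> (\<Sum>j<n. \<Sum>i<n. W i j)"
      using V unfolding W_def by (subst sum.swap)
    also have "\<dots> = (\<Sum>j\<in>{..<n} - S. \<Sum>i<n. W i j) + (\<Sum>j\<in>S. \<Sum>i<n. W i j)"
      using S(1) by (intro sum.subset_diff) auto
    also have "(\<Sum>j\<in>S. \<Sum>i<n. W i j) \<le> r * (m' * w)"
      using S colW sum_bounded_above[of S "\<lambda>j. \<Sum>i<n. W i j" "m' * w"] by auto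
    also have "(\<Sum>j\<in>{..<n} - S. \<Sum>i<n. W i j)
        = (\<Sum>j\<in>{..<n} - S. \<Sum>i\<in>{..<n} - G. W i j) + (\<Sum>j\<in>{..<n} - S. \<Sum>i\<in>G. W i j)"
      unfolding sum.distrib[symmetric]
      by (intro sum.cong refl sum.subset_diff) (auto simp: G_def)
    also have "(\<Sum>j\<in>{..<n} - S. \<Sum>i\<in>{..<n} - G. W i j) = (\<Sum>i\<in>{..<n} - G. \<Sum>j\<in>{..<n} - S. W i j)"
      by (rule sum.swap)
    also have "\<dots> \<le> (\<Sum>i\<in>{..<n} - G. m' * w)"
      by (intro sum_mono order_trans[OF sum_mono2 rowW]) (auto simp: W0)
    also have "\<dots> \<le> r * m * (m' * w)"
      using badG w by (simp add: mult_right_mono)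
    finally show ?thesis by simp
  qed
  show ?thesis
    unfolding css_l1_cost_def
  proof (rule cINF_greatest)
    fix X :: "real mat" assume "X \<in> carrier_mat (card S) (dim_col (shifted_mat n \<eta> \<Delta>))"
    then have X: "X \<in> carrier_mat r n" using S shifted_mat_carrier[OF \<Delta>, of \<eta>] by auto
    define C where "C j = (\<Sum>i<n. \<bar>\<eta> * ((\<Sum>l<r. X $$ (l, j)) - 1) + (\<Sum>l<r. X $$ (l, j) * \<Delta> $$ (i, pick S l)) - \<Delta> $$ (i, j)\<bar>)" for j
    have "a + (\<Sum>i\<in>G. W i j) / 4 \<le> C j" if j: "j < n" "j \<notin> S" for j
    proof -
      define p where "p l = (if l < r then pick S l else j)" for l
      have p_lt: "p \<in> {..<Suc r} \<rightarrow> {..<n}"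
        using j pick_lt[OF S(1)] S(2) by (auto simp: p_def)
      have p_inj: "inj_on p {..<Suc r}"
      proof -
        have "inj_on p {..<r}"
          using inj_on_pick[of S] S(2) by (simp add: p_def inj_on_def)
        moreover have "p r \<notin> p ` {..<r}"
          using j pick_in_set_le[of _ S] S(2) by (auto simp: p_def)
        ultimately show ?thesis by (simp add: lessThan_Suc)
      qed
      have "a + (\<Sum>i | i < n \<and> (\<forall>l<r. \<bar>\<Delta> $$ (i, p l)\<bar> < n). abs_within u w (\<Delta> $$ (i, p r))) / 4
          \<le> (\<Sum>i<n. \<bar>\<eta> * ((\<Sum>l<r. X $$ (l, j)) - 1) + (\<Sum>l<r. X $$ (l, j) * \<Delta> $$ (i, p l)) - \<Delta> $$ (i, p r)\<bar>)"
      proof (rule column_cost_ge[where D="\<lambda>i j. \<Delta> $$ (i, j)" and x="\<lambda>l. X $$ (l, j)" and A\<^sub>1=A\<^sub>1])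
        fix x :: "nat \<Rightarrow> real" and t :: real
        assume "0 < (\<Sum>l<Suc r. \<bar>x l\<bar>)" "\<bar>t\<bar> \<le> 2 * n * (\<Sum>l<Suc r. \<bar>x l\<bar>)"
        then show "(\<Sum>l<Suc r. \<bar>x l\<bar>) * A\<^sub>1 \<le> (\<Sum>i<n. \<bar>t + (\<Sum>l<Suc r. x l * \<Delta> $$ (i, p l))\<bar>)"
          unfolding A\<^sub>1_def
          by (intro sum_shifted_ge_of_grid[where D="\<lambda>i j. \<Delta> $$ (i, j)", OF N B grid p_inj p_lt refl]) auto
      qed (use p_lt m m'_col m' \<eta> a A\<^sub>1 in auto)
      also have "\<dots> = C j"
        by (simp add: C_def p_def)
      also have "(\<Sum>i | i < n \<and> (\<forall>l<r. \<bar>\<Delta> $$ (i, p l)\<bar> < n). abs_within u w (\<Delta> $$ (i, p r))) = (\<Sum>i\<in>G. W i j)"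
        by (intro sum.cong) (auto simp: G_def p_def W_def)
      finally show ?thesis .
    qed
    then have "(\<Sum>j\<in>{..<n} - S. a + (\<Sum>i\<in>G. W i j) / 4) \<le> (\<Sum>j\<in>{..<n} - S. C j)"
      by (intro sum_mono) auto
    also have "\<dots> \<le> (\<Sum>j<n. C j)"
      by (intro sum_mono2) (auto simp: C_def intro: sum_nonneg)
    also have "\<dots> = l1_norm_mat (col_submatrix (shifted_mat n \<eta> \<Delta>) S * X - shifted_mat n \<eta> \<Delta>)"
      unfolding l1_norm_residual[OF \<Delta> S X] C_def ..
    also have "(\<Sum>j\<in>{..<n} - S. a + (\<Sum>i\<in>G. W i j) / 4)
        = (real n - r) * a + (\<Sum>j\<in>{..<n} - S. \<Sum>i\<in>G. W i j) / 4"
    proof -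
      have "r \<le> n" using S card_mono[of "{..<n}" S] by auto
      then have "real (card ({..<n} - S)) = real n - r"
        using S finS by (simp add: card_Diff_subset of_nat_diff)
      then show ?thesis by (simp add: sum.distrib sum_divide_distrib)
    qed
    finally have "(real n - r) * a + (\<Sum>j\<in>{..<n} - S. \<Sum>i\<in>G. W i j) / 4
        \<le> l1_norm_mat (col_submatrix (shifted_mat n \<eta> \<Delta>) S * X - shifted_mat n \<eta> \<Delta>)" .
    moreover have "(V - (r * (m' * w) + r * m * (m' * w))) / 4 \<le> (\<Sum>j\<in>{..<n} - S. \<Sum>i\<in>G. W i j) / 4"
      using VW by (rule divide_right_mono) simp
    ultimately show "(real n - r) * a + (V - (r * (m' * w) + r * m * (m' * w))) / 4
        \<le> l1_norm_mat (col_submatrix (shifted_mat n \<eta> \<Delta>) S * X - shifted_mat n \<eta> \<Delta>)"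
      by linarith
  qed auto
qed

section \<open>The random matrix\<close>

lemma (in prob_space) indep_vars_inj_reindex:
  assumes ind: "indep_vars (\<lambda>_. N) X I" and f: "inj_on f J" "f ` J \<subseteq> I"
  shows "indep_vars (\<lambda>_. N) (\<lambda>j. X (f j)) J"
proof -
  have "indep_vars (\<lambda>j. PiM {f j} (\<lambda>_. N)) (\<lambda>j \<omega>. restrict (\<lambda>i. X i \<omega>) {f j}) J"
    using f by (intro indep_vars_restrict[OF ind]) (auto simp: disjoint_family_on_def inj_on_def)
  then have "indep_vars (\<lambda>_. N) (\<lambda>j \<omega>. (\<lambda>g. g (f j)) (restrict (\<lambda>i. X i \<omega>) {f j})) J"
    by (rule indep_vars_compose2) (auto intro!: measurable_component_singleton)
  then show ?thesis by simp
qed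

locale iid_cauchy_entries = prob_space M for M :: "'a measure" +
  fixes X :: "nat \<Rightarrow> nat \<Rightarrow> 'a \<Rightarrow> real" and n :: nat
  assumes indep: "indep_vars (\<lambda>_. borel) (\<lambda>(i, j). X i j) ({..<n} \<times> {..<n})"
    and cauchy: "\<And>i j. i < n \<Longrightarrow> j < n \<Longrightarrow> distributed M lborel (X i j) cauchy_density"
begin

lemma measurable_entry: "i < n \<Longrightarrow> j < n \<Longrightarrow> X i j \<in> borel_measurable M"
  using distributed_measurable[OF cauchy] by simp

lemma prob_entry_large:
  assumes "0 < B"
  shows "prob {\<omega> \<in> space M. \<exists>i<n. \<exists>j<n. B \<le> \<bar>X i j \<omega>\<bar>} \<le> (real n)\<^sup>2 * (2 / (pi * B))"
proof -
  let ?A = "\<lambda>(i, j). {\<omega> \<in> space M. B \<le> \<bar>X i j \<omega>\<bar>}"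
  have "prob (\<Union>ij\<in>{..<n} \<times> {..<n}. ?A ij) \<le> (\<Sum>ij\<in>{..<n} \<times> {..<n}. prob (?A ij))"
    using measurable_entry by (intro finite_measure_subadditive_finite) auto
  also have "\<dots> \<le> (\<Sum>ij\<in>{..<n} \<times> {..<n}. 2 / (pi * B))"
    using prob_cauchy_tail[OF cauchy assms] by (intro sum_mono) auto
  also have "(\<Union>ij\<in>{..<n} \<times> {..<n}. ?A ij) = {\<omega> \<in> space M. \<exists>i<n. \<exists>j<n. B \<le> \<bar>X i j \<omega>\<bar>}"
    by auto
  finally show ?thesis by (simp add: power2_eq_square)
qed

lemma indep_abs_within:
  "indep_vars (\<lambda>_. borel) (\<lambda>ij \<omega>. abs_within a b (X (fst ij) (snd ij) \<omega>)) ({..<n} \<times> {..<n})"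
  using indep_vars_compose2[OF indep, where Y="\<lambda>_ x. abs_within a b x" and N="\<lambda>_. borel"]
  by (simp add: split_beta)

lemma sum_entries: "(\<Sum>i<n. \<Sum>j<n. f i j) = (\<Sum>ij\<in>{..<n} \<times> {..<n}. f (fst ij) (snd ij))"
  by (simp add: sum.cartesian_product split_beta)

lemma prob_truncated_norm_ge:
  fixes B \<mu> \<epsilon> :: real
  assumes "0 < B" "ln (1 + B\<^sup>2) / pi \<le> \<mu>" "0 < \<epsilon>" "\<epsilon> \<le> 1"
  shows "prob {\<omega> \<in> space M. (1 + \<epsilon>) * ((real n)\<^sup>2 * \<mu>) \<le> (\<Sum>i<n. \<Sum>j<n. abs_within 0 B (X i j \<omega>))}
    \<le> exp (- ((real n)\<^sup>2 * \<mu> * \<epsilon>\<^sup>2 / (4 * B)))"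
proof -
  have "0 \<le> ln (1 + B\<^sup>2) / pi" by simp
  then have "0 \<le> \<mu>" using assms by linarith
  then have "prob {\<omega> \<in> space M. (1 + \<epsilon>) * (card ({..<n} \<times> {..<n}) * \<mu>)
        \<le> (\<Sum>ij\<in>{..<n} \<times> {..<n}. abs_within 0 B (X (fst ij) (snd ij) \<omega>))}
      \<le> exp (- (card ({..<n} \<times> {..<n}) * \<mu> * \<epsilon>\<^sup>2 / (4 * B)))"
    using assms
    by (intro bounded_sum_upper_tail indep_abs_within)
      (auto simp: abs_within_bounds expectation_cauchy_abs_within[OF cauchy])
  then show ?thesis
    by (simp add: sum_entries power2_eq_square[of "real n"])
qed

lemma prob_mid_entries_le:
  fixes u w \<mu> \<epsilon> :: real
  assumes "0 \<le> u" "u \<le> w" "0 < w" "0 \<le> \<mu>" "\<mu> \<le> (ln (1 + w\<^sup>2) - ln (1 + u\<^sup>2)) / pi" "0 < \<epsilon>" "\<epsilon> \<le> 1"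
  shows "prob {\<omega> \<in> space M. (\<Sum>i<n. \<Sum>j<n. abs_within u w (X i j \<omega>)) \<le> (1 - \<epsilon>) * ((real n)\<^sup>2 * \<mu>)}
    \<le> exp (- ((real n)\<^sup>2 * \<mu> * \<epsilon>\<^sup>2 / (4 * w)))"
proof -
  have "prob {\<omega> \<in> space M. (\<Sum>ij\<in>{..<n} \<times> {..<n}. abs_within u w (X (fst ij) (snd ij) \<omega>))
        \<le> (1 - \<epsilon>) * (card ({..<n} \<times> {..<n}) * \<mu>)}
      \<le> exp (- (card ({..<n} \<times> {..<n}) * \<mu> * \<epsilon>\<^sup>2 / (4 * w)))"
    using assms
    by (intro bounded_sum_lower_tail indep_abs_within)
      (auto simp: abs_within_bounds expectation_cauchy_abs_within[OF cauchy])
  then show ?thesis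
    by (simp add: sum_entries power2_eq_square[of "real n"])
qed

text \<open>\<open>Y j i\<close> is entry \<open>i\<close> on line \<open>j\<close>, so that columns
  and rows are both covered. Independence is used along each line, and the lines are combined by a
  union bound.\<close>

lemma prob_union_lines_count:
  fixes Y :: "nat \<Rightarrow> nat \<Rightarrow> 'a \<Rightarrow> real" and \<tau> l m :: real
  assumes ind: "\<And>j. j < n \<Longrightarrow> indep_vars (\<lambda>_. borel) (Y j) {..<n}"
    and Y: "\<And>i j. i < n \<Longrightarrow> j < n \<Longrightarrow> distributed M lborel (Y j i) cauchy_density"
    and \<tau>: "0 < \<tau>" and l: "0 < l"
  shows "prob {\<omega> \<in> space M. \<exists>j<n. m \<le> real (card {i \<in> {..<n}. \<tau> \<le> \<bar>Y j i \<omega>\<bar>})}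
      \<le> n * exp (n * (exp l * (2 / (pi * \<tau>))) - l * m)"
    and "{\<omega> \<in> space M. \<exists>j<n. m \<le> real (card {i \<in> {..<n}. \<tau> \<le> \<bar>Y j i \<omega>\<bar>})} \<in> events"
proof -
  let ?A = "\<lambda>j. {\<omega> \<in> space M. m \<le> real (card {i \<in> {..<n}. \<tau> \<le> \<bar>Y j i \<omega>\<bar>})}"
  have [measurable]: "Y j i \<in> borel_measurable M" if "i < n" "j < n" for i j
    using distributed_measurable[OF Y] that by simp
  have meas: "?A j \<in> events" if "j < n" for j
  proof -
    have "real (card {i \<in> {..<n}. \<tau> \<le> \<bar>Y j i \<omega>\<bar>}) = (\<Sum>i<n. indicator {\<tau>..} \<bar>Y j i \<omega>\<bar>)" for \<omega>
      by (simp add: indicator_def sum.If_cases Int_def)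
    moreover have "(\<lambda>\<omega>. \<Sum>i<n. indicat_real {\<tau>..} \<bar>Y j i \<omega>\<bar>) \<in> borel_measurable M"
      using that by (intro borel_measurable_sum) auto
    ultimately show ?thesis by simp
  qed
  have un: "(\<Union>j<n. ?A j) = {\<omega> \<in> space M. \<exists>j<n. m \<le> real (card {i \<in> {..<n}. \<tau> \<le> \<bar>Y j i \<omega>\<bar>})}"
    by auto
  show "{\<omega> \<in> space M. \<exists>j<n. m \<le> real (card {i \<in> {..<n}. \<tau> \<le> \<bar>Y j i \<omega>\<bar>})} \<in> events"
    unfolding un[symmetric] using meas by auto
  have "prob (\<Union>j<n. ?A j) \<le> (\<Sum>j<n. prob (?A j))"
    using meas by (intro finite_measure_subadditive_finite) auto
  also have "\<dots> \<le> (\<Sum>j<n. exp (n * (exp l * (2 / (pi * \<tau>))) - l * m))"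
    using prob_count_cauchy_ge[OF _ ind Y \<tau> l] by (intro sum_mono) auto
  finally show "prob {\<omega> \<in> space M. \<exists>j<n. m \<le> real (card {i \<in> {..<n}. \<tau> \<le> \<bar>Y j i \<omega>\<bar>})}
      \<le> n * exp (n * (exp l * (2 / (pi * \<tau>))) - l * m)"
    unfolding un by simp
qed

lemma indep_column: "j < n \<Longrightarrow> indep_vars (\<lambda>_. borel) (\<lambda>i. X i j) {..<n}"
  using indep_vars_inj_reindex[OF indep, of "\<lambda>i. (i, j)" "{..<n}"] by (auto simp: inj_on_def)

lemma indep_row: "i < n \<Longrightarrow> indep_vars (\<lambda>_. borel) (X i) {..<n}"
  using indep_vars_inj_reindex[OF indep, of "\<lambda>j. (i, j)" "{..<n}"] by (auto simp: inj_on_def)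

text \<open>Different rows involve disjoint sets of entries, so the row terms are independent.
  Truncating them at \<open>T\<close> only decreases the sum and makes the Chernoff bound for
  bounded variables applicable.\<close>

lemma prob_combination_le:
  fixes p :: "nat \<Rightarrow> nat" and c :: "nat \<Rightarrow> real" and t T \<mu> \<epsilon> :: real
  assumes p: "inj_on p {..<k}" "p \<in> {..<k} \<rightarrow> {..<n}"
    and c: "1 \<le> (\<Sum>l<k. \<bar>c l\<bar>)" and T: "0 < T"
    and \<mu>: "0 \<le> \<mu>" "\<mu> \<le> 2 / pi * ln (T / 2)" and \<epsilon>: "0 < \<epsilon>" "\<epsilon> \<le> 1"
  shows "prob {\<omega> \<in> space M. (\<Sum>i<n. \<bar>t + (\<Sum>l<k. c l * X i (p l) \<omega>)\<bar>) \<le> (1 - \<epsilon>) * (n * \<mu>)}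
    \<le> exp (- (n * \<mu> * \<epsilon>\<^sup>2 / (4 * T)))"
proof -
  define Y where "Y i \<omega> = min \<bar>t + (\<Sum>l<k. c l * X i (p l) \<omega>)\<bar> T" for i \<omega>
  have pl: "p l < n" if "l < k" for l using p(2) that by auto
  have "indep_vars (\<lambda>i. PiM ({i} \<times> {..<n}) (\<lambda>_. borel))
      (\<lambda>i \<omega>. restrict (\<lambda>ij. (case ij of (i, j) \<Rightarrow> X i j) \<omega>) ({i} \<times> {..<n})) {..<n}"
    by (intro indep_vars_restrict[OF indep]) (auto simp: disjoint_family_on_def)
  then have "indep_vars (\<lambda>_. borel)
      (\<lambda>i \<omega>. (\<lambda>g. min \<bar>t + (\<Sum>l<k. c l * g (i, p l))\<bar> T)
        (restrict (\<lambda>ij. (case ij of (i, j) \<Rightarrow> X i j) \<omega>) ({i} \<times> {..<n}))) {..<n}"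
  proof (rule indep_vars_compose2)
    fix i assume "i \<in> {..<n}"
    have [measurable]: "(\<lambda>g. g (i, p l)) \<in> borel_measurable (PiM ({i} \<times> {..<n}) (\<lambda>_. borel))" if "l \<in> {..<k}" for l
      using pl that by (intro measurable_component_singleton) auto
    show "(\<lambda>g. min \<bar>t + (\<Sum>l<k. c l * g (i, p l))\<bar> T) \<in> borel_measurable (PiM ({i} \<times> {..<n}) (\<lambda>_. borel))"
      by measurable
  qed
  then have indY: "indep_vars (\<lambda>_. borel) Y {..<n}"
    by (simp add: Y_def[abs_def] pl)
  have EY: "\<mu> \<le> expectation (Y i)" if i: "i < n" for i
  proof -
    have "indep_vars (\<lambda>_. borel) (\<lambda>l. X i (p l)) {..<k}"
      using indep_vars_inj_reindex[OF indep_row[OF i] p(1)] p(2) by auto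
    then have "2 / pi * ln (T / 2) \<le> expectation (Y i)"
      unfolding Y_def using cauchy[OF i pl] c T
      by (intro expectation_min_cauchy_linear_combination) auto
    then show ?thesis using \<mu> by simp
  qed
  have "prob {\<omega> \<in> space M. (\<Sum>i<n. \<bar>t + (\<Sum>l<k. c l * X i (p l) \<omega>)\<bar>) \<le> (1 - \<epsilon>) * (n * \<mu>)}
      \<le> prob {\<omega> \<in> space M. (\<Sum>i<n. Y i \<omega>) \<le> (1 - \<epsilon>) * (n * \<mu>)}"
  proof (rule finite_measure_mono)
    show "{\<omega> \<in> space M. (\<Sum>i<n. Y i \<omega>) \<le> (1 - \<epsilon>) * (n * \<mu>)} \<in> events"
    proof -
      have "(\<lambda>\<omega>. \<Sum>i<n. Y i \<omega>) \<in> borel_measurable M"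
        using indY by (intro borel_measurable_sum) (auto simp: indep_vars_def)
      then show ?thesis by simp
    qed
  next
    have "(\<Sum>i<n. Y i \<omega>) \<le> (\<Sum>i<n. \<bar>t + (\<Sum>l<k. c l * X i (p l) \<omega>)\<bar>)" for \<omega>
      by (intro sum_mono) (simp add: Y_def)
    then show "{\<omega> \<in> space M. (\<Sum>i<n. \<bar>t + (\<Sum>l<k. c l * X i (p l) \<omega>)\<bar>) \<le> (1 - \<epsilon>) * (n * \<mu>)}
      \<subseteq> {\<omega> \<in> space M. (\<Sum>i<n. Y i \<omega>) \<le> (1 - \<epsilon>) * (n * \<mu>)}"
      using order_trans by blast
  qed
  also have "\<dots> \<le> exp (- (n * \<mu> * \<epsilon>\<^sup>2 / (4 * T)))"
    using bounded_sum_lower_tail[OF _ indY, of T \<mu> \<epsilon>] EY T \<mu> \<epsilon> by (simp add: Y_def)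
  finally show ?thesis .
qed

section \<open>Union bound over the grid\<close>

text \<open>A triple consists of a list of distinct columns, the numerators of coefficients with
  denominator \<open>N\<close>, and a shift. Extensional functions make the set finite. The lower
  bound on the numerators says that the scale of the combination is at least 1.\<close>

definition grid :: "nat \<Rightarrow> nat \<Rightarrow> ((nat \<Rightarrow> nat) \<times> (nat \<Rightarrow> int) \<times> int) set" where
  "grid k N = {(p, q, t). p \<in> {..<k} \<rightarrow>\<^sub>E {..<n} \<and> inj_on p {..<k} \<and> q \<in> {..<k} \<rightarrow>\<^sub>E {- int N..int N}
      \<and> real N \<le> (\<Sum>l<k. \<bar>real_of_int (q l)\<bar>) \<and> t \<in> {- int (2 * n)..int (2 * n)}}"

lemma finite_grid: "finite (grid k N)"
  and card_grid: "card (grid k N) \<le> n ^ k * ((2 * N + 1) ^ k * (4 * n + 1))"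
proof -
  let ?S = "({..<k} \<rightarrow>\<^sub>E {..<n}) \<times> ({..<k} \<rightarrow>\<^sub>E {- int N..int N}) \<times> {- int (2 * n)..int (2 * n)}"
  have "grid k N \<subseteq> ?S" unfolding grid_def by blast
  moreover have fin: "finite ?S" by (intro finite_cartesian_product finite_PiE) auto
  ultimately show "finite (grid k N)" by (rule finite_subset)
  have "card (grid k N) \<le> card ?S"
    using \<open>grid k N \<subseteq> ?S\<close> fin by (rule card_mono[rotated])
  also have "\<dots> = n ^ k * ((2 * N + 1) ^ k * (4 * n + 1))"
  proof -
    have "card {- int N..int N} = 2 * N + 1" "card {- int (2 * n)..int (2 * n)} = 4 * n + 1"
      unfolding card_atLeastAtMost_int by linarith+
    then show ?thesis by (simp only: card_cartesian_product card_PiE finite_lessThan prod_constant card_lessThan)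
  qed
  finally show "card (grid k N) \<le> n ^ k * ((2 * N + 1) ^ k * (4 * n + 1))" .
qed

lemma prob_grid_le:
  fixes k N :: nat and T \<mu> \<epsilon> :: real
  assumes N: "0 < N" and T: "0 < T"
    and \<mu>: "0 \<le> \<mu>" "\<mu> \<le> 2 / pi * ln (T / 2)" and \<epsilon>: "0 < \<epsilon>" "\<epsilon> \<le> 1"
  defines "bad \<equiv> \<lambda>(p, q, t). {\<omega> \<in> space M.
      (\<Sum>i<n. \<bar>real_of_int t + (\<Sum>l<k. real_of_int (q l) / N * X i (p l) \<omega>)\<bar>) \<le> (1 - \<epsilon>) * (n * \<mu>)}"
  shows "prob (\<Union>z\<in>grid k N. bad z)
      \<le> real n ^ k * ((2 * real N + 1) ^ k * (4 * real n + 1)) * exp (- (n * \<mu> * \<epsilon>\<^sup>2 / (4 * T)))"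
    and "(\<Union>z\<in>grid k N. bad z) \<in> events"
proof -
  have meas: "bad z \<in> events" if z: "z \<in> grid k N" for z
  proof -
    obtain p q t where [simp]: "z = (p, q, t)" by (cases z)
    have "X i (p l) \<in> borel_measurable M" if "i < n" "l < k" for i l
      using z that by (intro measurable_entry) (auto simp: grid_def PiE_iff)
    then have "(\<lambda>\<omega>. \<Sum>i<n. \<bar>real_of_int t + (\<Sum>l<k. real_of_int (q l) / N * X i (p l) \<omega>)\<bar>) \<in> borel_measurable M"
      by (intro borel_measurable_sum borel_measurable_abs borel_measurable_add borel_measurable_times) auto
    then show ?thesis by (simp add: bad_def)
  qed
  then show "(\<Union>z\<in>grid k N. bad z) \<in> events"
    using finite_grid by (intro sets.finite_UN) auto
  have "prob (\<Union>z\<in>grid k N. bad z) \<le> (\<Sum>z\<in>grid k N. prob (bad z))"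
    using meas finite_grid by (intro finite_measure_subadditive_finite) auto
  also have "\<dots> \<le> (\<Sum>z\<in>grid k N. exp (- (n * \<mu> * \<epsilon>\<^sup>2 / (4 * T))))"
  proof (rule sum_mono)
    fix z assume z: "z \<in> grid k N"
    obtain p q t where [simp]: "z = (p, q, t)" by (cases z)
    have "1 \<le> (\<Sum>l<k. \<bar>real_of_int (q l) / N\<bar>)"
      using z N by (simp add: grid_def sum_divide_distrib[symmetric])
    then show "prob (bad z) \<le> exp (- (n * \<mu> * \<epsilon>\<^sup>2 / (4 * T)))"
      unfolding bad_def \<open>z = (p, q, t)\<close> prod.case using z T \<mu> \<epsilon>
      by (intro prob_combination_le) (auto simp: grid_def PiE_iff)
  qed
  also have "\<dots> = card (grid k N) * exp (- (n * \<mu> * \<epsilon>\<^sup>2 / (4 * T)))" by simp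
  also have "\<dots> \<le> real (n ^ k * ((2 * N + 1) ^ k * (4 * n + 1))) * exp (- (n * \<mu> * \<epsilon>\<^sup>2 / (4 * T)))"
    using card_grid by (intro mult_right_mono of_nat_mono) auto
  also have "real (n ^ k * ((2 * N + 1) ^ k * (4 * n + 1)))
      = real n ^ k * ((2 * real N + 1) ^ k * (4 * real n + 1))"
    by (simp add: algebra_simps)
  finally show "prob (\<Union>z\<in>grid k N. bad z)
      \<le> real n ^ k * ((2 * real N + 1) ^ k * (4 * real n + 1)) * exp (- (n * \<mu> * \<epsilon>\<^sup>2 / (4 * T)))" .
qed

end

section \<open>Measurability of the event\<close>

lemma floor_multiple_tendsto: "(\<lambda>k. real_of_int \<lfloor>real (Suc k) * x\<rfloor> / real (Suc k)) \<longlonglongrightarrow> x"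
proof -
  have "(\<lambda>k. real_of_int \<lfloor>real (Suc k) * x\<rfloor> / real (Suc k) - x) \<longlonglongrightarrow> 0"
  proof (rule Lim_null_comparison)
    have "norm (real_of_int \<lfloor>real (Suc k) * x\<rfloor> / real (Suc k) - x) \<le> inverse (real (Suc k))" for k
    proof -
      have "real_of_int \<lfloor>real (Suc k) * x\<rfloor> / real (Suc k) - x
          = (real_of_int \<lfloor>real (Suc k) * x\<rfloor> - real (Suc k) * x) / real (Suc k)"
        by (simp add: diff_divide_distrib)
      moreover have "\<bar>real_of_int \<lfloor>real (Suc k) * x\<rfloor> - real (Suc k) * x\<bar> \<le> 1"
        by linarith
      ultimately show ?thesis
        by (simp only: real_norm_def abs_divide inverse_eq_divide abs_of_nat) (rule divide_right_mono; simp)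
    qed
    then show "\<forall>\<^sub>F k in sequentially. norm (real_of_int \<lfloor>real (Suc k) * x\<rfloor> / real (Suc k) - x) \<le> inverse (real (Suc k))"
      by simp
  qed (rule LIMSEQ_inverse_real_of_nat)
  then show ?thesis by (simp add: LIM_zero_iff)
qed

text \<open>A countable dense set of candidates, by which the uncountable infimum in the cost
  becomes a countable condition.\<close>

definition rational_mats :: "nat \<Rightarrow> nat \<Rightarrow> real mat set" where
  "rational_mats r n = (\<lambda>g. mat r n (\<lambda>lj. of_rat (g lj))) ` (({..<r} \<times> {..<n}) \<rightarrow>\<^sub>E UNIV)"

lemma countable_rational_mats: "countable (rational_mats r n)"
  unfolding rational_mats_def by (intro countable_image countable_PiE) auto

lemma rational_mats_carrier: "X \<in> rational_mats r n \<Longrightarrow> X \<in> carrier_mat r n"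
  by (auto simp: rational_mats_def)

text \<open>The residual norm is continuous in \<open>X\<close>, so a lower bound on the rational
  matrices passes to their limits.\<close>

lemma le_css_l1_cost_iff:
  assumes D: "D \<in> carrier_mat n n" and S: "S \<subseteq> {..<n}" "card S = r"
  shows "c \<le> css_l1_cost (shifted_mat n \<eta> D) S \<longleftrightarrow> (\<forall>X\<in>rational_mats r n.
    c \<le> (\<Sum>j<n. \<Sum>i<n. \<bar>\<eta> * ((\<Sum>l<r. X $$ (l, j)) - 1) + (\<Sum>l<r. X $$ (l, j) * D $$ (i, pick S l)) - D $$ (i, j)\<bar>))"
    (is "_ \<longleftrightarrow> (\<forall>X\<in>_. c \<le> ?F X)")
proof -
  have "dim_col (shifted_mat n \<eta> D) = n" using shifted_mat_carrier[OF D, of \<eta>] by auto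
  then have "c \<le> css_l1_cost (shifted_mat n \<eta> D) S
      \<longleftrightarrow> c \<le> (INF X \<in> carrier_mat r n. l1_norm_mat (col_submatrix (shifted_mat n \<eta> D) S * X - shifted_mat n \<eta> D))"
    unfolding css_l1_cost_def S by simp
  also have "\<dots> \<longleftrightarrow> (\<forall>X\<in>carrier_mat r n.
      c \<le> l1_norm_mat (col_submatrix (shifted_mat n \<eta> D) S * X - shifted_mat n \<eta> D))"
  proof (rule le_cINF_iff)
    show "carrier_mat r n \<noteq> ({} :: real mat set)" using zero_carrier_mat[of r n] by blast
    show "bdd_below ((\<lambda>X. l1_norm_mat (col_submatrix (shifted_mat n \<eta> D) S * X - shifted_mat n \<eta> D)) ` carrier_mat r n)"
      by (rule bdd_belowI[of _ 0]) (auto simp: l1_norm_mat_def intro!: sum_nonneg)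
  qed
  also have "\<dots> \<longleftrightarrow> (\<forall>X\<in>carrier_mat r n. c \<le> ?F X)"
    using l1_norm_residual[OF D S] by simp
  also have "\<dots> \<longleftrightarrow> (\<forall>X\<in>rational_mats r n. c \<le> ?F X)"
  proof (intro iffI ballI)
    fix X :: "real mat"
    assume rat: "\<forall>X\<in>rational_mats r n. c \<le> ?F X" and X: "X \<in> carrier_mat r n"
    \<comment> \<open>Entries are rounded down to multiples of 1 / (k + 1); the successor avoids the
      denominator zero.\<close>
    define Y where "Y k = mat r n (\<lambda>lj. real_of_int \<lfloor>real (Suc k) * X $$ lj\<rfloor> / real (Suc k))" for k
    have "Y k \<in> rational_mats r n" for k
    proof -
      define g where "g = restrict (\<lambda>lj. of_int \<lfloor>real (Suc k) * X $$ lj\<rfloor> / of_nat (Suc k) :: rat) ({..<r} \<times> {..<n})"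
      have "Y k = mat r n (\<lambda>lj. of_rat (g lj))"
        unfolding Y_def g_def by (intro cong_mat) (auto simp: of_rat_divide of_rat_add)
      moreover have "g \<in> ({..<r} \<times> {..<n}) \<rightarrow>\<^sub>E UNIV" by (auto simp: g_def)
      ultimately show ?thesis unfolding rational_mats_def by blast
    qed
    then have "c \<le> ?F (Y k)" for k using rat by blast
    moreover have "(\<lambda>k. ?F (Y k)) \<longlonglongrightarrow> ?F X"
    proof -
      have "(\<lambda>k. Y k $$ (l, j)) \<longlonglongrightarrow> X $$ (l, j)" if "l < r" "j < n" for l j
        using that floor_multiple_tendsto[of "X $$ (l, j)"] by (simp add: Y_def)
      then show ?thesis by (intro tendsto_intros) auto
    qed
    ultimately show "c \<le> ?F X" by (intro LIMSEQ_le_const) auto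
  qed (auto dest: rational_mats_carrier)
  finally show ?thesis .
qed

text \<open>\<open>measure\<close> gives a non-measurable set the default value 0, so a lower bound
  on the probability requires the good event itself to be measurable.\<close>

lemma measurable_css_l1_cost_event:
  fixes \<Delta> :: "'a \<Rightarrow> real mat"
  assumes carrier: "\<And>\<omega>. \<omega> \<in> space M \<Longrightarrow> \<Delta> \<omega> \<in> carrier_mat n n"
    and meas: "\<And>i j. i < n \<Longrightarrow> j < n \<Longrightarrow> (\<lambda>\<omega>. \<Delta> \<omega> $$ (i, j)) \<in> borel_measurable M"
  shows "{\<omega> \<in> space M. \<forall>S. S \<subseteq> {..<n} \<and> card S = r \<longrightarrow>
    C * l1_norm_mat (\<Delta> \<omega>) \<le> css_l1_cost (shifted_mat n \<eta> (\<Delta> \<omega>)) S} \<in> sets M"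
proof -
  define F where "F S X \<omega> = (\<Sum>j<n. \<Sum>i<n. \<bar>\<eta> * ((\<Sum>l<r. X $$ (l, j)) - 1)
      + (\<Sum>l<r. X $$ (l, j) * \<Delta> \<omega> $$ (i, pick S l)) - \<Delta> \<omega> $$ (i, j)\<bar>)" for S X \<omega>
  define c where "c \<omega> = C * (\<Sum>i<n. \<Sum>j<n. \<bar>\<Delta> \<omega> $$ (i, j)\<bar>)" for \<omega>
  define \<S> where "\<S> = {S. S \<subseteq> {..<n} \<and> card S = r}"
  have c[measurable]: "c \<in> borel_measurable M"
    unfolding c_def using meas by (intro borel_measurable_times borel_measurable_sum borel_measurable_abs) auto
  have F[measurable]: "F S X \<in> borel_measurable M" if "S \<in> \<S>" for S X
    unfolding F_def using meas that pick_lt[of S n] unfolding \<S>_def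
    by (intro borel_measurable_sum borel_measurable_abs borel_measurable_add borel_measurable_diff
        borel_measurable_times borel_measurable_const) auto
  have "{\<omega> \<in> space M. \<forall>S. S \<subseteq> {..<n} \<and> card S = r \<longrightarrow>
      C * l1_norm_mat (\<Delta> \<omega>) \<le> css_l1_cost (shifted_mat n \<eta> (\<Delta> \<omega>)) S}
    = {\<omega> \<in> space M. \<forall>S\<in>\<S>. \<forall>X\<in>rational_mats r n. c \<omega> \<le> F S X \<omega>}"
  proof (intro Collect_cong conj_cong refl)
    fix \<omega> assume "\<omega> \<in> space M"
    note car = carrier[OF this]
    have "C * l1_norm_mat (\<Delta> \<omega>) = c \<omega>"
      using car by (simp add: l1_norm_mat_def c_def)
    then show "(\<forall>S. S \<subseteq> {..<n} \<and> card S = r \<longrightarrow> C * l1_norm_mat (\<Delta> \<omega>) \<le> css_l1_cost (shifted_mat n \<eta> (\<Delta> \<omega>)) S)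
        \<longleftrightarrow> (\<forall>S\<in>\<S>. \<forall>X\<in>rational_mats r n. c \<omega> \<le> F S X \<omega>)"
      unfolding \<S>_def F_def using le_css_l1_cost_iff[OF car] by auto
  qed
  moreover have "finite \<S>" unfolding \<S>_def by (rule finite_subset[of _ "Pow {..<n}"]) auto
  then have "{\<omega> \<in> space M. \<forall>S\<in>\<S>. \<forall>X\<in>rational_mats r n. c \<omega> \<le> F S X \<omega>} \<in> sets M"
    by (intro sets.sets_Collect_countable_All' countable_finite countable_rational_mats) auto
  ultimately show ?thesis by simp
qed

section \<open>Asymptotic estimates\<close>

text \<open>In units of (4 / pi) x ln x the last estimate compares 92/100 with 99/100 * 94/100 =
  0.9306, and the gap absorbs the terms of order x. The others compare different orders of
  growth.\<close>

lemma asymp_structural: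
  "\<forall>\<^sub>F x :: real in at_top. 2 * ((x powr (1/40) + 1) * (3 * ln x)) \<le> x"
  "\<forall>\<^sub>F x :: real in at_top. (x powr (1/40) + 1) * (x\<^sup>2 * ln (ln x)) / x ^ 5 \<le> 1"
  "\<forall>\<^sub>F x :: real in at_top. 4 * (92/100 * (4/pi) * ln x * x) \<le> x powr (21/20)"
  "\<forall>\<^sub>F x :: real in at_top. 2 * (92/100 * (4/pi) * ln x * x) \<le> x\<^sup>2"
  "\<forall>\<^sub>F x :: real in at_top. 3 * 60 * x \<le> 99/100 * (x * (94/100 * (2/pi) * ln x)) - 2 * x"
  "\<forall>\<^sub>F x :: real in at_top. 92/100 * (4/pi) * ln x * x * (1 + 2 / x) \<le> 2 * (99/100 * (x * (94/100 * (2/pi) * ln x)) - 2 * x)"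
  subgoal by real_asymp
  subgoal by real_asymp
  subgoal by real_asymp
  subgoal by real_asymp
  subgoal by real_asymp
  subgoal by real_asymp
  done

text \<open>The leading coefficients are rounded to leave room: 101/100 exceeds 1 and absorbs the
  iterated logarithm, 89/100 lies below 39/20 - 21/20 = 9/10, and 94/100 lies below 19/20.\<close>

lemma asymp_moments:
  shows "\<forall>\<^sub>F x :: real in at_top. ln (1 + (x\<^sup>2 * ln (ln x))\<^sup>2) / pi \<le> 101/100 * (4/pi) * ln x"
    and "\<forall>\<^sub>F x :: real in at_top. 89/100 * (2/pi) * ln x \<le> (ln (1 + (x powr (39/20))\<^sup>2) - ln (1 + (x powr (21/20))\<^sup>2)) / pi"
    and "\<forall>\<^sub>F x :: real in at_top. 94/100 * (2/pi) * ln x \<le> 2 / pi * ln (x powr (19/20) / 2)"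
proof -
  have "\<forall>\<^sub>F x :: real in at_top. ln (1 + (x\<^sup>2 * ln (ln x))\<^sup>2) \<le> 101/100 * 4 * ln x"
    by real_asymp
  then show "\<forall>\<^sub>F x :: real in at_top. ln (1 + (x\<^sup>2 * ln (ln x))\<^sup>2) / pi \<le> 101/100 * (4/pi) * ln x"
    by eventually_elim (simp add: field_simps)
  have "\<forall>\<^sub>F x :: real in at_top. 89/100 * 2 * ln x \<le> ln (1 + (x powr (39/20))\<^sup>2) - ln (1 + (x powr (21/20))\<^sup>2)"
    by real_asymp
  then show "\<forall>\<^sub>F x :: real in at_top. 89/100 * (2/pi) * ln x \<le> (ln (1 + (x powr (39/20))\<^sup>2) - ln (1 + (x powr (21/20))\<^sup>2)) / pi"
    by eventually_elim (simp add: field_simps)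
qed real_asymp

text \<open>The first bound decays like a power of exp (- ln x / ln ln x). In the third and fourth
  the inner exponentials of the mean stay bounded, leaving the powers x^(-2) and x^(-41/20). In the
  last one the logarithm of the grid size, of order x^(1/40) ln x, loses against x^(1/20) ln
  x.\<close>

lemma asymp_probabilities:
  "\<forall>\<^sub>F x :: real in at_top. exp (- (x\<^sup>2 * (101/100 * (4/pi) * ln x) * (1/100)\<^sup>2 / (4 * (x\<^sup>2 * ln (ln x))))) \<le> 1 / ln (ln x)"
  "\<forall>\<^sub>F x :: real in at_top. exp (- (x\<^sup>2 * (89/100 * (2/pi) * ln x) * (1/100)\<^sup>2 / (4 * x powr (39/20)))) \<le> 1 / ln (ln x)"
  "\<forall>\<^sub>F x :: real in at_top. x * exp (x * (exp 1 * (2 / (pi * x))) - 1 * (3 * ln x)) \<le> 1 / ln (ln x)"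
  "\<forall>\<^sub>F x :: real in at_top. x * exp (x * (exp (ln x / 20) * (2 / (pi * x powr (21/20)))) - ln x / 20 * 61) \<le> 1 / ln (ln x)"
  "\<forall>\<^sub>F x :: real in at_top. exp ((8 * (x powr (1/40) + 1) + 3) * ln x - x * (94/100 * (2/pi) * ln x) * (1/100)\<^sup>2 / (4 * x powr (19/20))) \<le> 1 / ln (ln x)"
  subgoal by real_asymp
  subgoal by real_asymp
  subgoal by real_asymp
  subgoal by real_asymp
  subgoal by real_asymp
  done

lemma asymp_prob_entry_large:
  "\<forall>\<^sub>F x :: real in at_top. x\<^sup>2 * (2 / (pi * (x\<^sup>2 * ln (ln x)))) \<le> 1 / ln (ln x)"
proof -
  have "\<forall>\<^sub>F x :: real in at_top. 0 < x" "\<forall>\<^sub>F x :: real in at_top. 0 < ln (ln x)"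
    by real_asymp+
  then show ?thesis
  proof eventually_elim
    case (elim x)
    have "x\<^sup>2 * (2 / (pi * (x\<^sup>2 * ln (ln x)))) = 2 / pi * (1 / ln (ln x))"
      using elim by simp
    also have "\<dots> \<le> 1 * (1 / ln (ln x))"
      using elim pi_ge_two by (intro mult_right_mono) auto
    finally show ?case by simp
  qed
qed

text \<open>In units of (4 / pi) x^2 ln x the left side is 1.002 * 1.01^2, about 1.0222. The right
  side has leading coefficient 0.92 + 0.99 * 0.89 / 8, about 1.0301. The subtracted terms are of
  lower order, the largest having the exponent 1/40 + 39/20 < 2.\<close>

lemma asymp_final:
  "\<forall>\<^sub>F x :: real in at_top. 1.002 * (101/100 * (x\<^sup>2 * (101/100 * (4/pi) * ln x)))
    \<le> (x - x powr (1/40)) * (92/100 * (4/pi) * ln x * x)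
      + (99/100 * (x\<^sup>2 * (89/100 * (2/pi) * ln x))
        - (x powr (1/40) * (60 * x powr (39/20)) + x powr (1/40) * (3 * ln x) * (60 * x powr (39/20)))) / 4"
  by real_asymp

lemma subpolynomial_eventually_le:
  assumes "subpolynomial r" "0 < c"
  shows "\<forall>\<^sub>F n in sequentially. real (r n) \<le> real n powr c"
proof -
  obtain e :: "nat \<Rightarrow> real" where e: "e \<in> o(\<lambda>_. 1)" "\<forall>\<^sub>F n in sequentially. real (r n) = real n powr e n"
    using assms(1) by (auto simp: subpolynomial_def)
  have "(e \<longlongrightarrow> 0) sequentially" using smalloD_tendsto[OF e(1)] by simp
  then have "\<forall>\<^sub>F n in sequentially. e n < c"
    using assms(2) by (rule order_tendstoD)
  moreover have "\<forall>\<^sub>F n :: nat in sequentially. 1 \<le> n" by (rule eventually_ge_at_top)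
  ultimately show ?thesis
    using e(2) by eventually_elim (auto intro!: powr_mono)
qed

text \<open>
  The parameters are \<open>\<delta> = 1/20\<close> in the exponents \<open>19/20\<close>, \<open>21/20\<close>, \<open>39/20\<close> of the truncation levels,
  \<open>1/40\<close> in the bound for \<open>r\<close>, relative error \<open>1/100\<close> in the Chernoff bounds, and grid width \<open>n\<^sup>-\<^sup>5\<close>.
\<close>

definition large_enough :: "real \<Rightarrow> bool" where
  "large_enough x \<longleftrightarrow>
    360 \<le> x \<and> 1 < ln x \<and>
    2 * ((x powr (1/40) + 1) * (3 * ln x)) \<le> x \<and>
    (x powr (1/40) + 1) * (x\<^sup>2 * ln (ln x)) / x ^ 5 \<le> 1 \<and>
    4 * (92/100 * (4/pi) * ln x * x) \<le> x powr (21/20) \<and>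
    2 * (92/100 * (4/pi) * ln x * x) \<le> x\<^sup>2 \<and>
    3 * 60 * x \<le> 99/100 * (x * (94/100 * (2/pi) * ln x)) - 2 * x \<and>
    92/100 * (4/pi) * ln x * x * (1 + 2 / x) \<le> 2 * (99/100 * (x * (94/100 * (2/pi) * ln x)) - 2 * x) \<and>
    ln (1 + (x\<^sup>2 * ln (ln x))\<^sup>2) / pi \<le> 101/100 * (4/pi) * ln x \<and>
    89/100 * (2/pi) * ln x \<le> (ln (1 + (x powr (39/20))\<^sup>2) - ln (1 + (x powr (21/20))\<^sup>2)) / pi \<and>
    94/100 * (2/pi) * ln x \<le> 2 / pi * ln (x powr (19/20) / 2) \<and>
    x\<^sup>2 * (2 / (pi * (x\<^sup>2 * ln (ln x)))) \<le> 1 / ln (ln x) \<and>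
    exp (- (x\<^sup>2 * (101/100 * (4/pi) * ln x) * (1/100)\<^sup>2 / (4 * (x\<^sup>2 * ln (ln x))))) \<le> 1 / ln (ln x) \<and>
    exp (- (x\<^sup>2 * (89/100 * (2/pi) * ln x) * (1/100)\<^sup>2 / (4 * x powr (39/20)))) \<le> 1 / ln (ln x) \<and>
    x * exp (x * (exp 1 * (2 / (pi * x))) - 1 * (3 * ln x)) \<le> 1 / ln (ln x) \<and>
    x * exp (x * (exp (ln x / 20) * (2 / (pi * x powr (21/20)))) - ln x / 20 * 61) \<le> 1 / ln (ln x) \<and>
    exp ((8 * (x powr (1/40) + 1) + 3) * ln x - x * (94/100 * (2/pi) * ln x) * (1/100)\<^sup>2 / (4 * x powr (19/20))) \<le> 1 / ln (ln x) \<and>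
    1.002 * (101/100 * (x\<^sup>2 * (101/100 * (4/pi) * ln x)))
      \<le> (x - x powr (1/40)) * (92/100 * (4/pi) * ln x * x)
        + (99/100 * (x\<^sup>2 * (89/100 * (2/pi) * ln x))
          - (x powr (1/40) * (60 * x powr (39/20)) + x powr (1/40) * (3 * ln x) * (60 * x powr (39/20)))) / 4"

lemma large_enoughD:
  assumes "large_enough x"
  shows "360 \<le> x"
    and "1 < ln x"
    and "2 * ((x powr (1/40) + 1) * (3 * ln x)) \<le> x"
    and "(x powr (1/40) + 1) * (x\<^sup>2 * ln (ln x)) / x ^ 5 \<le> 1"
    and "4 * (92/100 * (4/pi) * ln x * x) \<le> x powr (21/20)"
    and "2 * (92/100 * (4/pi) * ln x * x) \<le> x\<^sup>2"
    and "3 * 60 * x \<le> 99/100 * (x * (94/100 * (2/pi) * ln x)) - 2 * x"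
    and "92/100 * (4/pi) * ln x * x * (1 + 2 / x) \<le> 2 * (99/100 * (x * (94/100 * (2/pi) * ln x)) - 2 * x)"
    and "ln (1 + (x\<^sup>2 * ln (ln x))\<^sup>2) / pi \<le> 101/100 * (4/pi) * ln x"
    and "89/100 * (2/pi) * ln x \<le> (ln (1 + (x powr (39/20))\<^sup>2) - ln (1 + (x powr (21/20))\<^sup>2)) / pi"
    and "94/100 * (2/pi) * ln x \<le> 2 / pi * ln (x powr (19/20) / 2)"
    and "x\<^sup>2 * (2 / (pi * (x\<^sup>2 * ln (ln x)))) \<le> 1 / ln (ln x)"
    and "exp (- (x\<^sup>2 * (101/100 * (4/pi) * ln x) * (1/100)\<^sup>2 / (4 * (x\<^sup>2 * ln (ln x))))) \<le> 1 / ln (ln x)"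
    and "exp (- (x\<^sup>2 * (89/100 * (2/pi) * ln x) * (1/100)\<^sup>2 / (4 * x powr (39/20)))) \<le> 1 / ln (ln x)"
    and "x * exp (x * (exp 1 * (2 / (pi * x))) - 1 * (3 * ln x)) \<le> 1 / ln (ln x)"
    and "x * exp (x * (exp (ln x / 20) * (2 / (pi * x powr (21/20)))) - ln x / 20 * 61) \<le> 1 / ln (ln x)"
    and "exp ((8 * (x powr (1/40) + 1) + 3) * ln x - x * (94/100 * (2/pi) * ln x) * (1/100)\<^sup>2 / (4 * x powr (19/20))) \<le> 1 / ln (ln x)"
    and "1.002 * (101/100 * (x\<^sup>2 * (101/100 * (4/pi) * ln x)))
      \<le> (x - x powr (1/40)) * (92/100 * (4/pi) * ln x * x)
        + (99/100 * (x\<^sup>2 * (89/100 * (2/pi) * ln x))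
          - (x powr (1/40) * (60 * x powr (39/20)) + x powr (1/40) * (3 * ln x) * (60 * x powr (39/20)))) / 4"
  by (insert assms[unfolded large_enough_def]; elim conjE; assumption)+

lemma eventually_large_enough: "\<forall>\<^sub>F n in sequentially. large_enough (real n)"
proof -
  have "\<forall>\<^sub>F x :: real in at_top. 360 \<le> x" "\<forall>\<^sub>F x :: real in at_top. 1 < ln x"
    by real_asymp+
  then have "eventually large_enough at_top"
    unfolding large_enough_def
    by (intro eventually_conj asymp_structural asymp_moments asymp_prob_entry_large asymp_probabilities asymp_final)
  then show ?thesis using filterlim_real_sequentially by (rule eventually_compose_filterlim)
qed

text \<open>With N = x^5 there are at most x choices for each column and x^7 for each coefficient,
  and x^3 for the shift.\<close>

lemma grid_size_le:
  assumes "8 \<le> x"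
  shows "x ^ k * ((2 * x ^ 5 + 1) ^ k * (4 * x + 1)) \<le> exp ((8 * real k + 3) * ln x)"
proof -
  have "1 \<le> x ^ 5" using assms by simp
  then have "2 * x ^ 5 + 1 \<le> 3 * x ^ 5" by simp
  also have "\<dots> \<le> x * (x * x ^ 5)"
    using mult_mono[of 3 "x * x" "x ^ 5" "x ^ 5"] assms mult_mono[of 8 x 8 x] by (simp add: mult.assoc)
  also have "\<dots> = x ^ 7" by (simp add: power_add[symmetric] eval_nat_numeral)
  finally have 1: "(2 * x ^ 5 + 1) ^ k \<le> (x ^ 7) ^ k" using assms by (intro power_mono) auto
  have "4 * x + 1 \<le> 8 * x" using assms by simp
  also have "\<dots> \<le> x * x" using assms by (intro mult_right_mono) auto
  also have "\<dots> \<le> x ^ 3" using assms by (simp add: eval_nat_numeral)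
  finally have 2: "4 * x + 1 \<le> x ^ 3" .
  have "x ^ k * ((2 * x ^ 5 + 1) ^ k * (4 * x + 1)) \<le> x ^ k * ((x ^ 7) ^ k * x ^ 3)"
    using assms by (intro mult_left_mono mult_mono 1 2) auto
  also have "\<dots> = x ^ (8 * k + 3)"
    by (simp add: power_mult[symmetric] power_add[symmetric] algebra_simps)
  also have "\<dots> = exp (real (8 * k + 3) * ln x)"
    using assms by (simp only: exp_of_nat_mult) simp
  finally show ?thesis by simp
qed

section \<open>Bad events and the final estimate\<close>

text \<open>Seven bad events, each of probability at most 1 / ln ln n, account for the constant 7.
  Outside them the deterministic bound \<open>css_l1_cost_ge\<close> holds for every
  \<open>S\<close> at once.\<close>

lemma prob_css_l1_cost_ge:
  fixes M :: "'a measure" and \<Delta> :: "'a \<Rightarrow> real mat"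
  assumes M: "prob_space M" and \<Delta>: "iid_cauchy_mat M n \<Delta>"
    and r: "real r \<le> real n powr (1/40)" and c0: "2 \<le> c\<^sub>0" and n: "large_enough (real n)"
  shows "1 - 7 / ln (ln (real n)) \<le> measure M {\<omega> \<in> space M. \<forall>S. S \<subseteq> {..<n} \<and> card S = r \<longrightarrow>
    1.002 * l1_norm_mat (\<Delta> \<omega>) \<le> css_l1_cost (shifted_mat n (real n powr c\<^sub>0) (\<Delta> \<omega>)) S}"
proof -
  define X where "X i j \<omega> = \<Delta> \<omega> $$ (i, j)" for i j \<omega>
  interpret prob_space M by (rule M)
  have carrier: "\<Delta> \<omega> \<in> carrier_mat n n" if "\<omega> \<in> space M" for \<omega>
    using \<Delta> that by (simp add: iid_cauchy_mat_def)
  interpret iid_cauchy_entries M X n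
  proof
    show "indep_vars (\<lambda>_. borel) (\<lambda>(i, j). X i j) ({..<n} \<times> {..<n})"
      using \<Delta> by (simp add: iid_cauchy_mat_def X_def[abs_def])
    show "distributed M lborel (X i j) (\<lambda>x. ennreal (cauchy_density x))" if "i < n" "j < n" for i j
      using \<Delta> that by (simp add: iid_cauchy_mat_def X_def[abs_def])
  qed
  define L where "L = ln (real n)"
  define B where "B = (real n)\<^sup>2 * ln L"
  define u where "u = real n powr (21/20)"
  define w where "w = real n powr (39/20)"
  define T where "T = real n powr (19/20)"
  define k where "k = Suc r"
  define \<mu>B where "\<mu>B = 101/100 * (4/pi) * L"
  define \<mu>W where "\<mu>W = 89/100 * (2/pi) * L"
  define \<mu>T where "\<mu>T = 94/100 * (2/pi) * L"
  define a where "a = 92/100 * (4/pi) * L * n"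
  note large = large_enoughD[OF n, folded L_def, folded B_def \<mu>B_def \<mu>W_def \<mu>T_def u_def w_def T_def a_def]
  have n360: "360 \<le> n" and L1: "1 < L" using large(1,2) by auto
  then have n0: "0 < real n" and lL: "0 < ln L" by auto
  have B0: "0 < B" using n0 lL by (simp add: B_def)
  have T0: "0 < T" and w0: "0 < w" and u0: "0 < u" using n0 by (auto simp: T_def w_def u_def)
  have uw: "u \<le> w" unfolding u_def w_def using n360 by (intro powr_mono) auto
  have \<mu>0: "0 \<le> \<mu>W" "0 \<le> \<mu>T" using L1 by (auto simp: \<mu>W_def \<mu>T_def)
  have [measurable]: "X i j \<in> borel_measurable M" if "i < n" "j < n" for i j
    using measurable_entry that .
  \<comment> \<open>Outside \<open>E1\<close> no entry is lost by truncating at \<open>B\<close>, so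
    the sum in \<open>E2\<close> is the full norm; the same bound controls the rounding error of the
    grid.\<close>
  define E1 where "E1 = {\<omega> \<in> space M. \<exists>i<n. \<exists>j<n. B \<le> \<bar>X i j \<omega>\<bar>}"
  define E2 where "E2 = {\<omega> \<in> space M. (1 + 1/100) * ((real n)\<^sup>2 * \<mu>B) \<le> (\<Sum>i<n. \<Sum>j<n. abs_within 0 B (X i j \<omega>))}"
  define E3 where "E3 = {\<omega> \<in> space M. (\<Sum>i<n. \<Sum>j<n. abs_within u w (X i j \<omega>)) \<le> (1 - 1/100) * ((real n)\<^sup>2 * \<mu>W)}"
  \<comment> \<open>A column has at most 2 / pi such entries on average, so reaching 3 ln n is
    improbable even over all n columns.\<close>
  define E4 where "E4 = {\<omega> \<in> space M. \<exists>j<n. 3 * L \<le> real (card {i \<in> {..<n}. real n \<le> \<bar>X i j \<omega>\<bar>})}"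
  \<comment> \<open>The mean count on a line is of order n^(-1/20). With \<open>l = L / 20\<close>
    the factor \<open>exp l\<close> compensates this small mean, and n^(-61/20) beats the union over
    n lines. Outside the event the integer count is at most 60.\<close>
  define E5 where "E5 = {\<omega> \<in> space M. \<exists>j<n. 61 \<le> real (card {i \<in> {..<n}. u \<le> \<bar>X i j \<omega>\<bar>})}"
  define E6 where "E6 = {\<omega> \<in> space M. \<exists>i<n. 61 \<le> real (card {j \<in> {..<n}. u \<le> \<bar>X i j \<omega>\<bar>})}"
  define E7 where "E7 = (\<Union>z\<in>grid k (n ^ 5). (\<lambda>(p, q, t). {\<omega> \<in> space M.
      (\<Sum>i<n. \<bar>real_of_int t + (\<Sum>l<k. real_of_int (q l) / real (n ^ 5) * X i (p l) \<omega>)\<bar>) \<le> (1 - 1/100) * (n * \<mu>T)}) z)"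
  have E1: "E1 \<in> events" "prob E1 \<le> 1 / ln L"
  proof -
    have "E1 = (\<Union>i<n. \<Union>j<n. {\<omega> \<in> space M. B \<le> \<bar>X i j \<omega>\<bar>})" by (auto simp: E1_def)
    moreover have "{\<omega> \<in> space M. B \<le> \<bar>X i j \<omega>\<bar>} \<in> events" if "i < n" "j < n" for i j
      using that by measurable
    ultimately show "E1 \<in> events" by auto
    show "prob E1 \<le> 1 / ln L"
      unfolding E1_def using prob_entry_large[OF B0] large(12) by linarith
  qed
  have meas_sum: "(\<lambda>\<omega>. \<Sum>i<n. \<Sum>j<n. abs_within b c (X i j \<omega>)) \<in> borel_measurable M" for b c
    by (intro borel_measurable_sum) auto
  have E2: "E2 \<in> events" "prob E2 \<le> 1 / ln L"
  proof -
    show "E2 \<in> events"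
      unfolding E2_def by (rule borel_measurable_le[OF borel_measurable_const meas_sum])
    show "prob E2 \<le> 1 / ln L"
      unfolding E2_def by (rule order_trans[OF prob_truncated_norm_ge[OF B0 large(9)] large(13)]) simp_all
  qed
  have E3: "E3 \<in> events" "prob E3 \<le> 1 / ln L"
  proof -
    show "E3 \<in> events"
      unfolding E3_def by (rule borel_measurable_le[OF meas_sum borel_measurable_const])
    show "prob E3 \<le> 1 / ln L"
      unfolding E3_def
      by (rule order_trans[OF prob_mid_entries_le[OF less_imp_le[OF u0] uw w0 \<mu>0(1) large(10)] large(14)]) simp_all
  qed
  have "0 < n" "0 < L" using n360 L1 by auto
  note lines = indep_column indep_row cauchy this u0
  have E4: "E4 \<in> events" "prob E4 \<le> 1 / ln L"
    unfolding E4_def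
    by (rule prob_union_lines_count(2)[where l = 1]; auto intro: lines)
      (rule order_trans[OF prob_union_lines_count(1)[where l = 1] large(15)]; auto intro: lines)
  have E5: "E5 \<in> events" "prob E5 \<le> 1 / ln L"
    unfolding E5_def
    by (rule prob_union_lines_count(2)[where l = "L / 20"]; auto intro: lines)
      (rule order_trans[OF prob_union_lines_count(1)[where l = "L / 20"] large(16)]; auto intro: lines)
  have E6: "E6 \<in> events" "prob E6 \<le> 1 / ln L"
    unfolding E6_def
    by (rule prob_union_lines_count(2)[where l = "L / 20"]; auto intro: lines)
      (rule order_trans[OF prob_union_lines_count(1)[where l = "L / 20"] large(16)]; auto intro: lines)
  have kR: "real k \<le> real n powr (1/40) + 1" using r by (simp add: k_def)
  have E7: "E7 \<in> events" "prob E7 \<le> 1 / ln L"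
  proof -
    have N0: "0 < n ^ 5" using n360 by simp
    note * = large(11)
    show "E7 \<in> events"
      unfolding E7_def by (rule prob_grid_le(2)[OF N0 T0 \<mu>0(2) *, of "1/100"]) auto
    have "prob E7 \<le> real n ^ k * ((2 * real (n ^ 5) + 1) ^ k * (4 * real n + 1)) * exp (- (n * \<mu>T * (1/100)\<^sup>2 / (4 * T)))"
      unfolding E7_def by (rule prob_grid_le(1)[OF N0 T0 \<mu>0(2) *, of "1/100"]) auto
    also have "\<dots> \<le> exp ((8 * (real n powr (1/40) + 1) + 3) * L) * exp (- (n * \<mu>T * (1/100)\<^sup>2 / (4 * T)))"
    proof (rule mult_right_mono)
      have "real n ^ k * ((2 * real (n ^ 5) + 1) ^ k * (4 * real n + 1)) \<le> exp ((8 * real k + 3) * L)"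
        using grid_size_le[of "real n" k] n360 by (simp add: L_def)
      also have "\<dots> \<le> exp ((8 * (real n powr (1/40) + 1) + 3) * L)"
        using kR L1 by simp
      finally show "real n ^ k * ((2 * real (n ^ 5) + 1) ^ k * (4 * real n + 1)) \<le> exp ((8 * (real n powr (1/40) + 1) + 3) * L)" .
    qed simp
    also have "\<dots> = exp ((8 * (real n powr (1/40) + 1) + 3) * L - n * \<mu>T * (1/100)\<^sup>2 / (4 * T))"
      by (simp only: exp_add[symmetric] diff_conv_add_uminus)
    also have "\<dots> \<le> 1 / ln L" by (rule large(17))
    finally show "prob E7 \<le> 1 / ln L" .
  qed
  let ?good = "{\<omega> \<in> space M. \<forall>S. S \<subseteq> {..<n} \<and> card S = r \<longrightarrow>
    1.002 * l1_norm_mat (\<Delta> \<omega>) \<le> css_l1_cost (shifted_mat n (real n powr c\<^sub>0) (\<Delta> \<omega>)) S}"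
  let ?bad = "E1 \<union> (E2 \<union> (E3 \<union> (E4 \<union> (E5 \<union> (E6 \<union> E7)))))"
  have sub: "space M - ?bad \<subseteq> ?good"
  proof (intro subsetI CollectI conjI allI impI)
    fix \<omega> S
    assume "\<omega> \<in> space M - ?bad" and S: "S \<subseteq> {..<n} \<and> card S = r"
    then have \<omega>: "\<omega> \<in> space M" and notin: "\<omega> \<notin> E1" "\<omega> \<notin> E2" "\<omega> \<notin> E3" "\<omega> \<notin> E4" "\<omega> \<notin> E5" "\<omega> \<notin> E6" "\<omega> \<notin> E7"
      by auto
    have XB: "\<bar>X i j \<omega>\<bar> < B" if "i < n" "j < n" for i j
      using notin(1) \<omega> that by (auto simp: E1_def not_le)
    have norm: "l1_norm_mat (\<Delta> \<omega>) \<le> 101/100 * ((real n)\<^sup>2 * \<mu>B)"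
    proof -
      have "l1_norm_mat (\<Delta> \<omega>) = (\<Sum>i<n. \<Sum>j<n. abs_within 0 B (X i j \<omega>))"
        using carrier[OF \<omega>] XB
        by (auto simp: l1_norm_mat_def abs_within_def X_def less_imp_le intro!: sum.cong)
      then show ?thesis using notin(2) \<omega> by (simp add: E2_def)
    qed
    have cost: "(real n - r) * a + (99/100 * ((real n)\<^sup>2 * \<mu>W) - (r * (real 60 * w) + r * (3 * L) * (real 60 * w))) / 4
        \<le> css_l1_cost (shifted_mat n (real n powr c\<^sub>0) (\<Delta> \<omega>)) S"
    proof (rule css_l1_cost_ge[OF carrier[OF \<omega>], where N="n ^ 5" and B=B and u=u and A="99/100 * (n * \<mu>T)"])
      show "S \<subseteq> {..<n}" "card S = r" using S by auto
      show "0 < n ^ 5" using n360 by simp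
      show "\<bar>\<Delta> \<omega> $$ (i, j)\<bar> \<le> B" if "i < n" "j < n" for i j
        using XB[OF that] by (simp add: X_def)
      show "99/100 * ((real n)\<^sup>2 * \<mu>W) \<le> (\<Sum>i<n. \<Sum>j<n. abs_within u w (\<Delta> \<omega> $$ (i, j)))"
        using notin(3) \<omega> by (simp add: E3_def X_def)
      show "real (card {i \<in> {..<n}. real n \<le> \<bar>\<Delta> \<omega> $$ (i, j)\<bar>}) \<le> 3 * L" if "j < n" for j
        using notin(4) \<omega> that by (auto simp: E4_def X_def not_le intro: less_imp_le)
      show "card {i \<in> {..<n}. u \<le> \<bar>\<Delta> \<omega> $$ (i, j)\<bar>} \<le> 60" if "j < n" for j
        using notin(5) \<omega> that by (force simp: E5_def X_def not_le)
      show "card {j \<in> {..<n}. u \<le> \<bar>\<Delta> \<omega> $$ (i, j)\<bar>} \<le> 60" if "i < n" for i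
        using notin(6) \<omega> that by (force simp: E6_def X_def not_le)
      show "99/100 * (n * \<mu>T) \<le> (\<Sum>i<n. \<bar>real_of_int t + (\<Sum>l<Suc r. real_of_int (q l) / real (n ^ 5) * \<Delta> \<omega> $$ (i, p l))\<bar>)"
        if "inj_on p {..<Suc r}" "p \<in> {..<Suc r} \<rightarrow> {..<n}" "q \<in> {..<Suc r} \<rightarrow> {- int (n ^ 5)..int (n ^ 5)}"
          "t \<in> {- int (2 * n)..int (2 * n)}" "real (n ^ 5) \<le> (\<Sum>l<Suc r. \<bar>real_of_int (q l)\<bar>)" for p q t
      proof -
        \<comment> \<open>The grid contains extensional functions only; changing values at or beyond
          \<open>k\<close> does not affect the sums.\<close>
        let ?p = "restrict p {..<k}" and ?q = "restrict q {..<k}"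
        have "(\<Sum>l<k. \<bar>real_of_int (?q l)\<bar>) = (\<Sum>l<k. \<bar>real_of_int (q l)\<bar>)"
          by (intro sum.cong) auto
        then have "(?p, ?q, t) \<in> grid k (n ^ 5)"
          using that unfolding grid_def k_def[symmetric] by (auto simp: PiE_iff inj_on_def Pi_iff)
        then have "\<not> (\<Sum>i<n. \<bar>real_of_int t + (\<Sum>l<k. real_of_int (?q l) / real (n ^ 5) * X i (?p l) \<omega>)\<bar>) \<le> (1 - 1/100) * (n * \<mu>T)"
          using notin(7) \<omega> unfolding E7_def by blast
        moreover have "(\<Sum>l<k. real_of_int (?q l) / real (n ^ 5) * X i (?p l) \<omega>)
            = (\<Sum>l<k. real_of_int (q l) / real (n ^ 5) * X i (p l) \<omega>)" for i
          by (intro sum.cong) auto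
        ultimately show ?thesis unfolding k_def X_def by simp
      qed
      show "2 * (real (Suc r) * (3 * L)) \<le> n"
      proof -
        have "2 * (real k * (3 * L)) \<le> 2 * ((real n powr (1/40) + 1) * (3 * L))"
          using kR L1 by (intro mult_left_mono mult_right_mono) auto
        then show ?thesis using large(3) unfolding k_def by linarith
      qed
      \<comment> \<open>The denominator n^5 dominates (r + 1) B, so rounding costs at most 2 per
        row.\<close>
      have A1: "99/100 * (n * \<mu>T) - 2 * n \<le> 99/100 * (n * \<mu>T) - n * (real (Suc r) * B / real (n ^ 5) + 1)"
      proof -
        have "real (Suc r) * B / real (n ^ 5) \<le> (real n powr (1/40) + 1) * B / real n ^ 5"
          using kR B0 unfolding k_def by (auto intro!: divide_right_mono mult_right_mono)
        also have "\<dots> \<le> 1" by (rule large(4))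
        finally have "n * (real (Suc r) * B / real (n ^ 5)) \<le> real n * 1"
          by (intro mult_left_mono) auto
        then show ?thesis by (simp add: distrib_left)
      qed
      show "3 * 60 * n \<le> 99/100 * (n * \<mu>T) - n * (real (Suc r) * B / real (n ^ 5) + 1)"
        using A1 large(7) by linarith
      show "a * (1 + 2 * n / (n powr c\<^sub>0)) \<le> 2 * (99/100 * (n * \<mu>T) - n * (real (Suc r) * B / real (n ^ 5) + 1))"
      proof -
        \<comment> \<open>This is where \<open>2 \<le> c\<^sub>0\<close> enters: \<eta> >= n^2
          reduces the correction 2 n / \<eta> to at most 2 / n.\<close>
        have "real n powr 2 \<le> n powr c\<^sub>0" using n360 c0 by (intro powr_mono) auto
        then have "2 * real n / (n powr c\<^sub>0) \<le> 2 * real n / (real n powr 2)"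
          using n0 by (intro divide_left_mono) auto
        also have "\<dots> = 2 / n" using n0 by (simp add: power2_eq_square)
        finally have "a * (1 + 2 * n / (n powr c\<^sub>0)) \<le> a * (1 + 2 / n)"
          using L1 by (intro mult_left_mono) (auto simp: a_def)
        also have "\<dots> \<le> 2 * (99/100 * (n * \<mu>T) - 2 * n)"
          using large(8) by simp
        also have "\<dots> \<le> 2 * (99/100 * (n * \<mu>T) - n * (real (Suc r) * B / real (n ^ 5) + 1))"
          using A1 by (rule mult_left_mono) simp
        finally show ?thesis .
      qed
    qed (use large(5,6) n360 n0 w0 in auto)
    have "1.002 * l1_norm_mat (\<Delta> \<omega>) \<le> 1.002 * (101/100 * ((real n)\<^sup>2 * \<mu>B))"
      using norm by (rule mult_left_mono) simp
    also have "\<dots> \<le> (real n - n powr (1/40)) * a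
        + (99/100 * ((real n)\<^sup>2 * \<mu>W) - (n powr (1/40) * (60 * w) + n powr (1/40) * (3 * L) * (60 * w))) / 4"
      by (rule large(18))
    \<comment> \<open>The lower bound decreases as \<open>r\<close> grows, so it may be estimated at
      the largest admissible value n^(1/40).\<close>
    also have "\<dots> \<le> (real n - r) * a + (99/100 * ((real n)\<^sup>2 * \<mu>W) - (r * (real 60 * w) + r * (3 * L) * (real 60 * w))) / 4"
      using r L1 w0 n0 unfolding of_nat_numeral a_def
      by (intro add_mono divide_right_mono diff_left_mono mult_right_mono diff_mono) auto
    also have "\<dots> \<le> css_l1_cost (shifted_mat n (real n powr c\<^sub>0) (\<Delta> \<omega>)) S"
      by (rule cost)
    finally show "1.002 * l1_norm_mat (\<Delta> \<omega>) \<le> css_l1_cost (shifted_mat n (real n powr c\<^sub>0) (\<Delta> \<omega>)) S" .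
  qed auto
  have bad: "?bad \<in> events" using E1 E2 E3 E4 E5 E6 E7 by auto
  have good: "?good \<in> events"
    using measurable_css_l1_cost_event[of M \<Delta> n r "1.002", OF carrier] measurable_entry by (simp add: X_def[abs_def])
  have "prob ?bad \<le> prob E1 + (prob E2 + (prob E3 + (prob E4 + (prob E5 + (prob E6 + prob E7)))))"
    using E1 E2 E3 E4 E5 E6 E7
    by (intro order_trans[OF measure_Un_le] add_left_mono) auto
  also have "\<dots> \<le> 7 / ln L"
    using E1 E2 E3 E4 E5 E6 E7 by simp
  finally have "1 - 7 / ln L \<le> prob (space M - ?bad)"
    using bad by (simp add: prob_compl)
  also have "\<dots> \<le> prob ?good"
    by (rule finite_measure_mono[OF sub good])
  finally show ?thesis unfolding L_def .
qed

theorem theoremB20: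
  shows "\<exists>(C\<^sub>0::real) (K::real). \<forall>c\<^sub>0\<ge>C\<^sub>0. \<forall>r :: nat \<Rightarrow> nat. subpolynomial r \<longrightarrow>
    (\<forall>\<^sub>F n in sequentially. \<forall>(M :: 'a measure) (\<Delta> :: 'a \<Rightarrow> real mat).
       prob_space M \<and> iid_cauchy_mat M n \<Delta> \<longrightarrow>
       measure M {\<omega> \<in> space M. \<forall>S. S \<subseteq> {..<n} \<and> card S = r n \<longrightarrow>
           css_l1_cost (shifted_mat n (real n powr c\<^sub>0) (\<Delta> \<omega>)) S \<ge> 1.002 * l1_norm_mat (\<Delta> \<omega>)}
         \<ge> 1 - K / ln (ln (real n)))"
proof (intro exI allI impI)
  fix c\<^sub>0 :: real and r :: "nat \<Rightarrow> nat"
  \<comment> \<open>This fixes the witness 2 for \<open>C\<^sub>0\<close>; the goal below fixes 7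
    for \<open>K\<close>. The threshold on \<open>n\<close> depends on \<open>r\<close> but not on
    \<open>M\<close> or \<open>\<Delta>\<close>.\<close>
  assume c0: "2 \<le> c\<^sub>0" and "subpolynomial r"
  then have "\<forall>\<^sub>F n in sequentially. real (r n) \<le> real n powr (1/40)"
    by (intro subpolynomial_eventually_le) auto
  then show "\<forall>\<^sub>F n in sequentially. \<forall>(M :: 'a measure) (\<Delta> :: 'a \<Rightarrow> real mat).
       prob_space M \<and> iid_cauchy_mat M n \<Delta> \<longrightarrow>
       measure M {\<omega> \<in> space M. \<forall>S. S \<subseteq> {..<n} \<and> card S = r n \<longrightarrow>
           css_l1_cost (shifted_mat n (real n powr c\<^sub>0) (\<Delta> \<omega>)) S \<ge> 1.002 * l1_norm_mat (\<Delta> \<omega>)}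
         \<ge> 1 - 7 / ln (ln (real n))"
    using eventually_large_enough
    by eventually_elim (use prob_css_l1_cost_ge c0 in blast)
qed

end
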